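(* Suppose the model is a Markov model with common known initial distribution $q^{(0)}$, and under $\theta_0$ the chain is aperiodic, positive Harris and $V$-geometrically ergodic for some $V:S\to[1,\infty)$: there are an invariant density $q_{\theta_0}$ with $\int V\,dq_{\theta_0}<\infty$ and constants $R<\infty$, $\tau\in(0,1)$ such that $\sup_{|g|\le V}\big|\mathrm{E}_{\theta_0}[g(X_n)|X_0=x]-\int g\,q_{\theta_0}\big|\le RV(x)\tau^n$ for all $x$ and $n$. Assume there are nonnegative functions $M^{(1)}_k$ and functions $f^{(1)}_k$, $k=1,\dots,m$, with $|\log p_{\theta_1}(y|x)-\log p_{\theta_2}(y|x)|\le\sum_{k=1}^m M^{(1)}_k(y,x)|f^{(1)}_k(\theta_2,\theta_1)|$ for all $\theta_1,\theta_2,x,y$, and, for some $\delta>0$, $\int M^{(1)}_k(y,x)^{2+\delta}p_{\theta_0}(y|x)\,dy<V(x)$ for all $k,x$; that there are $C>0$ and $\rho_n\in\mathcal{F}$ with $\int|f^{(1)}_k(\theta,\theta_0)|^{2+\delta}\rho_n(d\theta)\le C/n$ and $\int|f^{(1)}_k(\theta,\theta_0)|\rho_n(d\theta)\le C/\sqrt n$ for all $k,n$; that $\mathcal{K}(\rho_n,\pi)\le C\sqrt n$; and that $\mathrm{E}_{q^{(0)}}[V(X_0)]<\infty$. Then there exist $\epsilon_n=O\big(\max(n^{-1/2},n^{\delta/2}/n)\big)$ such that conditions (C1)–(C3) hold for $\rho_n$ and $\epsilon_n$.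
   Context: Markov model with known initial distribution: for each $\theta\in\Theta\subseteq\mathbb{R}^d$, $p_\theta(y|x)$ is a transition density on the state space $S\subseteq\mathbb{R}^m$ (w.r.t. Lebesgue or counting measure), and $P^{(n)}_\theta$ is the law of $(X_0,\dots,X_n)$ with density $q^{(0)}(x_0)\prod_{i=1}^n p_\theta(x_i|x_{i-1})$, the same $q^{(0)}$ for all $\theta$. $\mathrm{E},\mathrm{Var}$ are under $P^{(n)}_{\theta_0}$. $r_n(\theta,\theta_0):=\log(p^{(n)}_{\theta_0}(X^n)/p^{(n)}_\theta(X^n))$; $\mathcal{K}$ is KL divergence; $\pi$ is a prior and $\mathcal{F}$ a family of distributions on $\Theta$. Conditions: (C1) $\int\mathcal{K}(P^{(n)}_{\theta_0},P^{(n)}_\theta)\rho_n(d\theta)\le n\epsilon_n$; (C2) $\int\mathrm{Var}(r_n(\theta,\theta_0))\rho_n(d\theta)\le n\epsilon_n$; (C3) $\mathcal{K}(\rho_n,\pi)\le n\epsilon_n$. $\epsilon_n=O(a_n)$ means $\epsilon_n\le Ka_n$ for some constant $K$ and all $n$. *)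

theory Defs
  imports "HOL-Probability.Probability"
begin

text \<open>The state space carries a base measure mu (restricted Lebesgue or counting
measure on S); p theta y x is the transition density of y given x.\<close>

definition kern :: "'x measure \<Rightarrow> ('p \<Rightarrow> 'x \<Rightarrow> 'x \<Rightarrow> real) \<Rightarrow> 'p \<Rightarrow> 'x \<Rightarrow> 'x measure" where
  "kern \<mu> p \<theta> x = density \<mu> (\<lambda>y. ennreal (p \<theta> y x))"

fun nstep :: "'x measure \<Rightarrow> ('p \<Rightarrow> 'x \<Rightarrow> 'x \<Rightarrow> real) \<Rightarrow> 'p \<Rightarrow> nat \<Rightarrow> 'x \<Rightarrow> 'x measure" where
  "nstep \<mu> p \<theta> 0 x = return \<mu> x"
| "nstep \<mu> p \<theta> (Suc n) x = bind (nstep \<mu> p \<theta> n x) (kern \<mu> p \<theta>)"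

text \<open>Probability, starting at x, that the chain visits A at some time in 1..k.\<close>
fun hitprob :: "'x measure \<Rightarrow> ('p \<Rightarrow> 'x \<Rightarrow> 'x \<Rightarrow> real) \<Rightarrow> 'p \<Rightarrow> 'x set \<Rightarrow> nat \<Rightarrow> 'x \<Rightarrow> ennreal" where
  "hitprob \<mu> p \<theta> A 0 x = 0"
| "hitprob \<mu> p \<theta> A (Suc k) x =
     (\<integral>\<^sup>+ y. (if y \<in> A then 1 else hitprob \<mu> p \<theta> A k y) \<partial>kern \<mu> p \<theta> x)"

text \<open>L(x,A) = P_x(tau_A < infinity), tau_A the first return time (times >= 1).\<close>
definition Lret :: "'x measure \<Rightarrow> ('p \<Rightarrow> 'x \<Rightarrow> 'x \<Rightarrow> real) \<Rightarrow> 'p \<Rightarrow> 'x set \<Rightarrow> 'x \<Rightarrow> ennreal" where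
  "Lret \<mu> p \<theta> A x = (SUP k. hitprob \<mu> p \<theta> A k x)"

definition irred_measure :: "'x measure \<Rightarrow> ('p \<Rightarrow> 'x \<Rightarrow> 'x \<Rightarrow> real) \<Rightarrow> 'p \<Rightarrow> 'x measure \<Rightarrow> bool" where
  "irred_measure \<mu> p \<theta> \<phi> \<longleftrightarrow> sets \<phi> = sets \<mu> \<and> sigma_finite_measure \<phi> \<and> emeasure \<phi> (space \<mu>) > 0 \<and>
     (\<forall>A\<in>sets \<mu>. emeasure \<phi> A > 0 \<longrightarrow> (\<forall>x\<in>space \<mu>. Lret \<mu> p \<theta> A x > 0))"

text \<open>Harris recurrence: some nonzero sigma-finite phi such that every phi-positive
set is reached with probability one from every starting point (Meyn--Tweedie 9.1).\<close>
definition harris :: "'x measure \<Rightarrow> ('p \<Rightarrow> 'x \<Rightarrow> 'x \<Rightarrow> real) \<Rightarrow> 'p \<Rightarrow> bool" where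
  "harris \<mu> p \<theta> \<longleftrightarrow> (\<exists>\<phi>. sets \<phi> = sets \<mu> \<and> sigma_finite_measure \<phi> \<and> emeasure \<phi> (space \<mu>) > 0 \<and>
     (\<forall>A\<in>sets \<mu>. emeasure \<phi> A > 0 \<longrightarrow> (\<forall>x\<in>space \<mu>. Lret \<mu> p \<theta> A x = 1)))"

definition invariant_prob :: "'x measure \<Rightarrow> ('p \<Rightarrow> 'x \<Rightarrow> 'x \<Rightarrow> real) \<Rightarrow> 'p \<Rightarrow> 'x measure \<Rightarrow> bool" where
  "invariant_prob \<mu> p \<theta> \<nu> \<longleftrightarrow> prob_space \<nu> \<and> sets \<nu> = sets \<mu> \<and> bind \<nu> (kern \<mu> p \<theta>) = \<nu>"

definition positive_harris :: "'x measure \<Rightarrow> ('p \<Rightarrow> 'x \<Rightarrow> 'x \<Rightarrow> real) \<Rightarrow> 'p \<Rightarrow> bool" where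
  "positive_harris \<mu> p \<theta> \<longleftrightarrow> harris \<mu> p \<theta> \<and> (\<exists>\<nu>. invariant_prob \<mu> p \<theta> \<nu>)"

text \<open>Aperiodicity: there is no d-cycle with d >= 2 whose complement is null for
the maximal irreducibility measure (equivalently, for every irreducibility measure).\<close>
definition aperiodic :: "'x measure \<Rightarrow> ('p \<Rightarrow> 'x \<Rightarrow> 'x \<Rightarrow> real) \<Rightarrow> 'p \<Rightarrow> bool" where
  "aperiodic \<mu> p \<theta> \<longleftrightarrow> \<not> (\<exists>d::nat. d \<ge> 2 \<and> (\<exists>D :: nat \<Rightarrow> 'x set.
      (\<forall>i<d. D i \<in> sets \<mu> \<and> D i \<noteq> {}) \<and> disjoint_family_on D {..<d} \<and>
      (\<forall>i<d. \<forall>x\<in>D i. emeasure (kern \<mu> p \<theta> x) (D (Suc i mod d)) = 1) \<and>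
      (\<forall>\<phi>. irred_measure \<mu> p \<theta> \<phi> \<longrightarrow> emeasure \<phi> (space \<mu> - (\<Union>i<d. D i)) = 0)))"

definition V_geom_ergodic :: "'x measure \<Rightarrow> ('p \<Rightarrow> 'x \<Rightarrow> 'x \<Rightarrow> real) \<Rightarrow> 'p \<Rightarrow> ('x \<Rightarrow> real)
    \<Rightarrow> ('x \<Rightarrow> real) \<Rightarrow> real \<Rightarrow> real \<Rightarrow> bool" where
  "V_geom_ergodic \<mu> p \<theta> V q R \<tau> \<longleftrightarrow> (\<forall>x\<in>space \<mu>. \<forall>n. integrable (nstep \<mu> p \<theta> n x) V \<and>
     (\<forall>g\<in>borel_measurable \<mu>. (\<forall>y\<in>space \<mu>. \<bar>g y\<bar> \<le> V y) \<longrightarrow>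
        \<bar>(\<integral>y. g y \<partial>nstep \<mu> p \<theta> n x) - (\<integral>y. g y * q y \<partial>\<mu>)\<bar> \<le> R * V x * \<tau> ^ n))"

definition pathdens :: "('x \<Rightarrow> real) \<Rightarrow> ('p \<Rightarrow> 'x \<Rightarrow> 'x \<Rightarrow> real) \<Rightarrow> 'p \<Rightarrow> nat \<Rightarrow> (nat \<Rightarrow> 'x) \<Rightarrow> real" where
  "pathdens q0 p \<theta> n xs = q0 (xs 0) * (\<Prod>i\<in>{1..n}. p \<theta> (xs i) (xs (i - 1)))"

definition pathlaw :: "'x measure \<Rightarrow> ('x \<Rightarrow> real) \<Rightarrow> ('p \<Rightarrow> 'x \<Rightarrow> 'x \<Rightarrow> real) \<Rightarrow> 'p \<Rightarrow> nat \<Rightarrow> (nat \<Rightarrow> 'x) measure" where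
  "pathlaw \<mu> q0 p \<theta> n = density (PiM {0..n} (\<lambda>_. \<mu>)) (\<lambda>xs. ennreal (pathdens q0 p \<theta> n xs))"

definition rn :: "('x \<Rightarrow> real) \<Rightarrow> ('p \<Rightarrow> 'x \<Rightarrow> 'x \<Rightarrow> real) \<Rightarrow> 'p \<Rightarrow> 'p \<Rightarrow> nat \<Rightarrow> (nat \<Rightarrow> 'x) \<Rightarrow> real" where
  "rn q0 p \<theta> \<theta>0 n xs = ln (pathdens q0 p \<theta>0 n xs / pathdens q0 p \<theta> n xs)"

definition KL :: "'a measure \<Rightarrow> 'a measure \<Rightarrow> ereal" where
  "KL P Q = (if sets P = sets Q \<and> absolutely_continuous Q P then
      enn2ereal (\<integral>\<^sup>+x. ennreal (ln (enn2real (RN_deriv Q P x))) \<partial>P)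
      - enn2ereal (\<integral>\<^sup>+x. ennreal (- ln (enn2real (RN_deriv Q P x))) \<partial>P)
    else \<infinity>)"

definition Var :: "'a measure \<Rightarrow> ('a \<Rightarrow> real) \<Rightarrow> ennreal" where
  "Var P X = (if integrable P X then (\<integral>\<^sup>+x. ennreal ((X x - (\<integral>y. X y \<partial>P))\<^sup>2) \<partial>P) else \<infinity>)"

end

(*
  Under theta_0 the log-likelihood ratio is a sum of increments Z_i = z(X_i, X_(i-1)) whose
  conditional second moment given X_(i-1) = x is at most a^2 V(x), where a is a multiple of
  sum_k |f_k(theta, theta_0)|.  Since E V(X_n) is bounded, E|r_n| = O(n a), which bounds the
  Kullback-Leibler divergence.  For the variance, centre at c, the stationary mean of
  h(x) = E[Z_1 | X_0 = x].  As |h| <= a sqrt V, geometric ergodicity (used for h truncated at a level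
  of sqrt V) gives |E_x h(X_l) - c| <= const * a * sqrt(V x) * tau^(l/2), so the products
  E[(Z_i - c)(Z_j - c)] decay geometrically in j - i and E[(r_n - n c)^2] = O(n a^2).  Finally
  t^2 <= t + t^(2+delta) turns the moment bounds on f_k into integrals of a and a^2 against rho_n
  of order n^(-1/2), so epsilon_n = K / sqrt n already suffices.
*)
theory Submission
  imports Defs
begin

section \<open>Products of counting measures\<close>

text \<open>The shape of the variance bound comes from having only second moments of the increments.
  Since sqrt V <= V, geometric ergodicity applies to h directly, but its error then grows like V(x),
  and the product of V(X_i) with an increment need not be integrable when only E V(X_i) is
  controlled. An error of order sqrt(V x) can be paired with an increment by the inequality between
  arithmetic and geometric means; the price is the rate sqrt \<tau> in place of \<tau>. Centring at
  a stationary constant is harmless although the chain does not start in stationarity, because a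
  variance is at most the second moment about any point. For a fixed \<theta> the increments enter
  only through one number, the amplitude a. All other constants depend on the chain under \<theta>0
  alone, so that integration over \<open>\<rho> n\<close> concerns only the first two moments of
  sum_k |f_k|. The base measure is a Lebesgue measure or a possibly uncountable counting measure;
  both are reduced to one rule for integrating out the last coordinate of a path, on which path
  laws, marginals and the Markov property rest.\<close>

text \<open>The state space may be uncountable, so the library's theory of products of
sigma-finite measures does not cover \<open>count_space S\<close>.\<close>

lemma prod_ennreal_eq_top:
  fixes f :: "'i \<Rightarrow> ennreal"
  assumes "finite I" "i \<in> I" "f i = \<infinity>" "\<And>j. j \<in> I \<Longrightarrow> f j \<noteq> 0"
  shows "prod f I = \<infinity>"
proof -
  have "prod f (I - {i}) \<noteq> 0"
    using assms by auto
  moreover have "prod f I = f i * prod f (I - {i})"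
    using assms(1,2) by (rule prod.remove)
  ultimately show ?thesis
    using assms(3) by (simp add: ennreal_top_mult)
qed

text \<open>An empty side has to be separated from an infinite one:
  \<open>0 * \<infinity> = 0\<close> in \<open>ennreal\<close>, so an empty side makes the box empty
  and the product zero, and only when every side is nonempty does an infinite side make both
  infinite.\<close>

lemma emeasure_count_space_PiE:
  assumes "finite I" and sub: "\<And>i. i \<in> I \<Longrightarrow> A i \<subseteq> S"
  shows "emeasure (count_space (\<Pi>\<^sub>E i\<in>I. S)) (\<Pi>\<^sub>E i\<in>I. A i) = (\<Prod>i\<in>I. emeasure (count_space S) (A i))"
proof -
  have subset: "(\<Pi>\<^sub>E i\<in>I. A i) \<subseteq> (\<Pi>\<^sub>E i\<in>I. S)"
    using sub by (intro PiE_mono)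
  consider (empty) i where "i \<in> I" "A i = {}"
    | (inf) i where "i \<in> I" "infinite (A i)" "\<And>i. i \<in> I \<Longrightarrow> A i \<noteq> {}"
    | (fin) "\<And>i. i \<in> I \<Longrightarrow> finite (A i)"
    by blast
  then show ?thesis
  proof cases
    case empty
    then have "(\<Pi>\<^sub>E i\<in>I. A i) = {}"
      by (auto simp: PiE_eq_empty_iff)
    moreover have "(\<Prod>i\<in>I. emeasure (count_space S) (A i)) = 0"
      using empty \<open>finite I\<close> by (intro prod_zero bexI[of _ i]) auto
    ultimately show ?thesis by simp
  next
    case inf
    then have "infinite (\<Pi>\<^sub>E i\<in>I. A i)"
      using \<open>finite I\<close> by (auto simp: finite_PiE_iff PiE_eq_empty_iff)
    moreover have "(\<Prod>i\<in>I. emeasure (count_space S) (A i)) = \<infinity>"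
      using inf sub \<open>finite I\<close> by (intro prod_ennreal_eq_top[where i=i]) (auto simp: emeasure_count_space)
    ultimately show ?thesis
      using subset by (simp add: emeasure_count_space)
  next
    case fin
    then have "finite (\<Pi>\<^sub>E i\<in>I. A i)"
      using \<open>finite I\<close> by (intro finite_PiE) auto
    then show ?thesis
      using subset sub fin \<open>finite I\<close>
      by (simp add: emeasure_count_space card_PiE prod_ennreal flip: ennreal_of_nat_eq_real_of_nat of_nat_prod)
  qed
qed

text \<open>A product measure is some measure with prescribed values on boxes, and without
  sigma-finiteness these values need not determine it. Points, however, are boxes of measure one;
  additivity then settles finite sets, and monotonicity gives infinite measure to every infinite
  measurable set.\<close>

lemma emeasure_PiM_count_space:
  assumes fin: "finite I" and A: "A \<in> sets (PiM I (\<lambda>_. count_space S))"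
  shows "emeasure (PiM I (\<lambda>_. count_space S)) A = emeasure (count_space (\<Pi>\<^sub>E i\<in>I. S)) A"
proof -
  let ?P = "PiM I (\<lambda>_. count_space S)" and ?C = "count_space (\<Pi>\<^sub>E i\<in>I. S)"
  have sets_sub: "sets ?P \<subseteq> sets ?C"
    using sets.space_closed[of ?P] by (simp add: space_PiM)
  \<comment> \<open>The counting measure on the product shows that the prescribed values on boxes
    are consistent, so \<open>PiM\<close> takes them as well. In these values a coordinate outside
    \<open>J\<close> appears only if its total mass differs from one.\<close>
  have rect: "emeasure ?P (prod_emb I (\<lambda>_. count_space S) J (Pi\<^sub>E J X)) =
     (\<Prod>j\<in>J \<union> {i \<in> I. emeasure (count_space S) (space (count_space S)) \<noteq> 1}.
        if j \<in> J then emeasure (count_space S) (X j) else emeasure (count_space S) (space (count_space S)))"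
    if "(J \<noteq> {} \<or> I = {}) \<and> finite J \<and> J \<subseteq> I \<and> X \<in> (\<Pi> j\<in>J. sets (count_space S))" for J X
  proof (subst emeasure_extend_measure_Pair[OF PiM_def, where \<mu>'="emeasure ?C"])
    fix J X assume JX: "(J \<noteq> {} \<or> I = {}) \<and> finite J \<and> J \<subseteq> I \<and> X \<in> (\<Pi> j\<in>J. sets (count_space S))"
    have "emeasure ?C (prod_emb I (\<lambda>_. count_space S) J (Pi\<^sub>E J X))
       = emeasure ?C (\<Pi>\<^sub>E i\<in>I. if i \<in> J then X i else S)"
      using JX by (subst prod_emb_PiE) (simp_all add: Pi_iff cong: if_cong)
    also have "\<dots> = (\<Prod>i\<in>I. emeasure (count_space S) (if i \<in> J then X i else S))"
      using JX by (intro emeasure_count_space_PiE fin) (auto simp: Pi_iff split: if_splits)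
    also have "\<dots> = (\<Prod>j\<in>J \<union> {i \<in> I. emeasure (count_space S) (space (count_space S)) \<noteq> 1}.
        emeasure (count_space S) (if j \<in> J then X j else S))"
      using JX by (intro prod.mono_neutral_right fin) auto
    finally show "emeasure ?C (prod_emb I (\<lambda>_. count_space S) J (Pi\<^sub>E J X)) =
      (\<Prod>j\<in>J \<union> {i \<in> I. emeasure (count_space S) (space (count_space S)) \<noteq> 1}.
        if j \<in> J then emeasure (count_space S) (X j) else emeasure (count_space S) (space (count_space S)))"
      by (simp add: if_distrib cong: if_cong)
  next
    show "positive (sets ?P) (emeasure ?C)"
      by (simp add: positive_def)
    show "countably_additive (sets ?P) (emeasure ?C)"
      using sets_sub by (intro countably_additiveI suminf_emeasure) auto
  qed (use that in \<open>auto simp: prod_emb_def\<close>)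
  have single: "{x} \<in> sets ?P \<and> emeasure ?P {x} = 1" if x: "x \<in> (\<Pi>\<^sub>E i\<in>I. S)" for x
  proof -
    have eq: "{x} = prod_emb I (\<lambda>_. count_space S) I (\<Pi>\<^sub>E i\<in>I. {x i})"
      using x by (subst prod_emb_PiE_same_index) (auto simp: PiE_singleton PiE_iff)
    have "emeasure ?P {x} = (\<Prod>j\<in>I \<union> {i \<in> I. emeasure (count_space S) (space (count_space S)) \<noteq> 1}.
        if j \<in> I then emeasure (count_space S) {x j} else emeasure (count_space S) (space (count_space S)))"
      unfolding eq using x fin by (subst rect) (auto simp: PiE_iff)
    also have "\<dots> = 1"
      using x by (intro prod.neutral) (auto simp: PiE_iff)
    finally have "emeasure ?P {x} = 1" .
    moreover have "{x} \<in> sets ?P"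
      unfolding eq using x fin by (intro sets_PiM_I) (auto simp: PiE_iff)
    ultimately show ?thesis by simp
  qed
  have finite_eq: "B \<in> sets ?P \<and> emeasure ?P B = of_nat (card B)" if "finite B" "B \<subseteq> (\<Pi>\<^sub>E i\<in>I. S)" for B
  proof -
    have "(\<Union>x\<in>B. {x}) \<in> sets ?P"
      using that single by (intro sets.finite_UN) auto
    moreover have "emeasure ?P (\<Union>x\<in>B. {x}) = (\<Sum>x\<in>B. emeasure ?P {x})"
      using that single by (intro sum_emeasure[symmetric]) (auto simp: disjoint_family_on_def)
    moreover have "\<dots> = of_nat (card B)"
      using that single by (simp add: subset_eq)
    ultimately show ?thesis by simp
  qed
  have A_sub: "A \<subseteq> (\<Pi>\<^sub>E i\<in>I. S)"
    using A sets_sub by auto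
  show ?thesis
  proof (cases "finite A")
    case True
    then show ?thesis
      using finite_eq[OF True A_sub] A_sub by (simp add: emeasure_count_space)
  next
    case False
    have "of_nat n \<le> emeasure ?P A" for n
    proof -
      obtain B where B: "B \<subseteq> A" "finite B" "card B = n"
        using False infinite_arbitrarily_large by blast
      then have "emeasure ?P B = of_nat n"
        using finite_eq[of B] A_sub by auto
      then show ?thesis
        using emeasure_mono[OF B(1) A] by simp
    qed
    then have "emeasure ?P A = \<infinity>"
      by (metis ennreal_SUP_of_nat_eq_top SUP_least infinity_ennreal_def top.extremum_unique)
    then show ?thesis
      using False A_sub by (simp add: emeasure_count_space)
  qed
qed

lemma nn_integral_count_space_Times:
  "(\<integral>\<^sup>+x. \<integral>\<^sup>+y. h (x, y) \<partial>count_space B \<partial>count_space A) = (\<integral>\<^sup>+z. h z \<partial>count_space (A \<times> B))"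
proof -
  have "(\<integral>\<^sup>+x. \<integral>\<^sup>+y. h (x, y) \<partial>count_space B \<partial>count_space A)
      = (\<integral>\<^sup>+x. (\<integral>\<^sup>+y. h (x, y) * indicator B y \<partial>count_space UNIV) * indicator A x \<partial>count_space UNIV)"
    by (subst (1 2) nn_integral_restrict_space[symmetric]) (simp_all add: restrict_count_space)
  also have "\<dots> = (\<integral>\<^sup>+x. \<integral>\<^sup>+y. h (x, y) * indicator (A \<times> B) (x, y) \<partial>count_space UNIV \<partial>count_space UNIV)"
    by (intro nn_integral_cong) (auto simp: indicator_def intro!: nn_integral_cong)
  also have "\<dots> = (\<integral>\<^sup>+z. h z * indicator (A \<times> B) z \<partial>count_space UNIV)"
    by (rule nn_integral_fst_count_space)
  also have "\<dots> = (\<integral>\<^sup>+z. h z \<partial>count_space (A \<times> B))"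
    by (subst nn_integral_restrict_space[symmetric]) (simp_all add: restrict_count_space)
  finally show ?thesis .
qed

text \<open>The product sigma-algebra can be smaller than the power set; for functions measurable
  with respect to it the two integrals agree because the two measures agree on it.\<close>

lemma nn_integral_PiM_count_space:
  assumes "finite I" "f \<in> borel_measurable (PiM I (\<lambda>_. count_space S))"
  shows "(\<integral>\<^sup>+x. f x \<partial>PiM I (\<lambda>_. count_space S)) = (\<integral>\<^sup>+x. f x \<partial>count_space (\<Pi>\<^sub>E i\<in>I. S))"
proof (rule nn_integral_subalgebra)
  show "sets (PiM I (\<lambda>_. count_space S)) \<subseteq> sets (count_space (\<Pi>\<^sub>E i\<in>I. S))"
    using sets.space_closed[of "PiM I (\<lambda>_. count_space S)"] by (simp add: space_PiM)
qed (use assms in \<open>simp_all add: space_PiM emeasure_PiM_count_space\<close>)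

text \<open>Over counting measure the claim is summation over a product of two sets, rearranged by
  the bijection (g, y) -> g(i := y). The hypothesis \<open>inner\<close> is what lets the outer
  integral return to the product measure.\<close>

lemma nn_integral_PiM_count_space_insert:
  assumes I: "finite I" "i \<notin> I"
    and f: "f \<in> borel_measurable (PiM (insert i I) (\<lambda>_. count_space S))"
    and inner: "(\<lambda>x. \<integral>\<^sup>+y. f (x(i := y)) \<partial>count_space S) \<in> borel_measurable (PiM I (\<lambda>_. count_space S))"
  shows "(\<integral>\<^sup>+x. f x \<partial>PiM (insert i I) (\<lambda>_. count_space S))
    = (\<integral>\<^sup>+x. \<integral>\<^sup>+y. f (x(i := y)) \<partial>count_space S \<partial>PiM I (\<lambda>_. count_space S))"
proof -
  have bij: "bij_betw (\<lambda>(g, y). g(i := y)) ((\<Pi>\<^sub>E j\<in>I. S) \<times> S) (\<Pi>\<^sub>E j\<in>insert i I. S)"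
  proof (rule bij_betw_imageI)
    show "inj_on (\<lambda>(g, y). g(i := y)) ((\<Pi>\<^sub>E j\<in>I. S) \<times> S)"
      using inj_combinator[OF I(2), of "\<lambda>_. S"] by (auto simp: inj_on_def)
    show "(\<lambda>(g, y). g(i := y)) ` ((\<Pi>\<^sub>E j\<in>I. S) \<times> S) = (\<Pi>\<^sub>E j\<in>insert i I. S)"
      unfolding PiE_insert_eq by force
  qed
  have "(\<integral>\<^sup>+x. f x \<partial>PiM (insert i I) (\<lambda>_. count_space S))
      = (\<integral>\<^sup>+x. f x \<partial>count_space (\<Pi>\<^sub>E j\<in>insert i I. S))"
    using I f by (intro nn_integral_PiM_count_space) auto
  also have "\<dots> = (\<integral>\<^sup>+z. f (case z of (g, y) \<Rightarrow> g(i := y)) \<partial>count_space ((\<Pi>\<^sub>E j\<in>I. S) \<times> S))"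
    by (rule nn_integral_bij_count_space[OF bij, symmetric])
  also have "\<dots> = (\<integral>\<^sup>+x. \<integral>\<^sup>+y. f (x(i := y)) \<partial>count_space S \<partial>count_space (\<Pi>\<^sub>E j\<in>I. S))"
    by (subst nn_integral_count_space_Times[symmetric]) simp
  also have "\<dots> = (\<integral>\<^sup>+x. \<integral>\<^sup>+y. f (x(i := y)) \<partial>count_space S \<partial>PiM I (\<lambda>_. count_space S))"
    using I inner by (intro nn_integral_PiM_count_space[symmetric]) auto
  finally show ?thesis .
qed

lemma sigma_finite_restrict_lborel:
  fixes S :: "'a::euclidean_space set"
  shows "sigma_finite_measure (restrict_space lborel S)"
proof (cases "S \<in> sets (lborel :: 'a measure)")
  case True
  then show ?thesis
    by (intro sigma_finite_measure_restrict_space) (auto intro: sigma_finite_lborel)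
next
  case False
  then have "emeasure (lborel :: 'a measure) S = 0"
    by (rule emeasure_notin_sets)
  \<comment> \<open>The trace of Lebesgue measure on a non-Borel set is the null measure.\<close>
  then have "emeasure (restrict_space lborel S) S = 0"
    unfolding restrict_space_def by (simp add: emeasure_measure_of_conv)
  then have "finite_measure (restrict_space lborel S)"
    by (intro finite_measureI) (simp add: space_restrict_space)
  then show ?thesis
    by (simp add: finite_measure_def)
qed

section \<open>Path laws and the Markov property\<close>

text \<open>Splitting into positive and negative parts lifts a disintegration formula from
  nonnegative to integrable real functions. \<open>\<phi>\<close> is arbitrary so that the lemma
  serves both for extending a path by one coordinate and for composing an n-step law with the
  kernel.\<close>

lemma integral_disintegration:
  fixes g :: "'b \<Rightarrow> real"
  assumes nn: "\<And>h :: 'b \<Rightarrow> ennreal. h \<in> borel_measurable Q' \<Longrightarrow>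
      (\<integral>\<^sup>+z. h z \<partial>Q') = (\<integral>\<^sup>+x. \<integral>\<^sup>+y. h (\<phi> x y) \<partial>K x \<partial>Q)"
    and meas: "\<And>h :: 'b \<Rightarrow> ennreal. h \<in> borel_measurable Q' \<Longrightarrow>
      (\<lambda>x. \<integral>\<^sup>+y. h (\<phi> x y) \<partial>K x) \<in> borel_measurable Q"
    and \<phi>: "\<And>x. x \<in> space Q \<Longrightarrow> \<phi> x \<in> measurable (K x) Q'"
    and g: "integrable Q' g"
  shows "integrable Q (\<lambda>x. \<integral>y. g (\<phi> x y) \<partial>K x)"
    and "(\<integral>z. g z \<partial>Q') = (\<integral>x. \<integral>y. g (\<phi> x y) \<partial>K x \<partial>Q)"
proof -
  have [measurable]: "g \<in> borel_measurable Q'"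
    using g by auto
  define P where "P x = (\<integral>\<^sup>+y. ennreal (g (\<phi> x y)) \<partial>K x)" for x
  define N where "N x = (\<integral>\<^sup>+y. ennreal (- g (\<phi> x y)) \<partial>K x)" for x
  have [measurable]: "P \<in> borel_measurable Q" "N \<in> borel_measurable Q"
    unfolding P_def N_def by (auto intro!: meas[of "\<lambda>z. ennreal (g z)"] meas[of "\<lambda>z. ennreal (- g z)"])
  have P_eq: "(\<integral>\<^sup>+x. P x \<partial>Q) = (\<integral>\<^sup>+z. ennreal (g z) \<partial>Q')"
    and N_eq: "(\<integral>\<^sup>+x. N x \<partial>Q) = (\<integral>\<^sup>+z. ennreal (- g z) \<partial>Q')"
    unfolding P_def N_def by (auto intro!: nn[symmetric])
  have fin: "(\<integral>\<^sup>+x. P x \<partial>Q) \<noteq> \<infinity>" "(\<integral>\<^sup>+x. N x \<partial>Q) \<noteq> \<infinity>"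
    using g unfolding P_eq N_eq real_integrable_def by auto
  have AE_P: "AE x in Q. P x \<noteq> \<infinity>" and AE_N: "AE x in Q. N x \<noteq> \<infinity>"
    using nn_integral_noteq_infinite[OF _ fin(1)] nn_integral_noteq_infinite[OF _ fin(2)] by auto
  \<comment> \<open>A Bochner integral is 0 where integrability fails, so the inner integral is an
    explicit function of \<open>P\<close> and \<open>N\<close> at every point. Its measurability
    follows from theirs, and not merely up to a null set.\<close>
  have inner: "(\<integral>y. g (\<phi> x y) \<partial>K x) =
      (if P x \<noteq> \<infinity> \<and> N x \<noteq> \<infinity> then enn2real (P x) - enn2real (N x) else 0)" if "x \<in> space Q" for x
  proof -
    have [measurable]: "(\<lambda>y. g (\<phi> x y)) \<in> borel_measurable (K x)"
      using \<phi>[OF that] by measurable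
    have "integrable (K x) (\<lambda>y. g (\<phi> x y)) \<longleftrightarrow> P x \<noteq> \<infinity> \<and> N x \<noteq> \<infinity>"
      unfolding real_integrable_def P_def N_def by auto
    then show ?thesis
      using not_integrable_integral_eq[of "K x" "\<lambda>y. g (\<phi> x y)"]
      by (auto simp: real_lebesgue_integral_def P_def N_def)
  qed
  have meas_inner: "(\<lambda>x. \<integral>y. g (\<phi> x y) \<partial>K x) \<in> borel_measurable Q"
    by (subst measurable_cong[OF inner]) auto
  have nn_enn2real: "(\<integral>\<^sup>+x. ennreal (enn2real (P x)) \<partial>Q) = (\<integral>\<^sup>+x. P x \<partial>Q)"
    "(\<integral>\<^sup>+x. ennreal (enn2real (N x)) \<partial>Q) = (\<integral>\<^sup>+x. N x \<partial>Q)"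
    using AE_P AE_N by (auto intro!: nn_integral_cong_AE simp: less_top)
  have int_P: "integrable Q (\<lambda>x. enn2real (P x))" and int_N: "integrable Q (\<lambda>x. enn2real (N x))"
    using fin nn_enn2real by (auto intro!: integrableI_nonneg simp: less_top)
  have AE_inner: "AE x in Q. enn2real (P x) - enn2real (N x) = (\<integral>y. g (\<phi> x y) \<partial>K x)"
    using AE_P AE_N AE_space by eventually_elim (simp add: inner)
  show "integrable Q (\<lambda>x. \<integral>y. g (\<phi> x y) \<partial>K x)"
    by (rule integrable_cong_AE_imp[OF Bochner_Integration.integrable_diff[OF int_P int_N] meas_inner AE_inner])
  have "(\<integral>x. \<integral>y. g (\<phi> x y) \<partial>K x \<partial>Q) = (\<integral>x. enn2real (P x) - enn2real (N x) \<partial>Q)"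
    using AE_inner by (intro integral_cong_AE meas_inner) auto
  also have "\<dots> = enn2real (\<integral>\<^sup>+x. P x \<partial>Q) - enn2real (\<integral>\<^sup>+x. N x \<partial>Q)"
    using int_P int_N by (simp add: integral_eq_nn_integral nn_enn2real)
  also have "\<dots> = (\<integral>z. g z \<partial>Q')"
    unfolding P_eq N_eq by (rule real_lebesgue_integral_def[OF g, symmetric])
  finally show "(\<integral>z. g z \<partial>Q') = (\<integral>x. \<integral>y. g (\<phi> x y) \<partial>K x \<partial>Q)" ..
qed

text \<open>In the sigma-finite case Fubini supplies measurability of the inner integral; to cover
  both base measures it is a hypothesis, which for path laws follows from measurability of the
  kernel.\<close>

lemma nn_integral_PiM_insert:
  assumes base: "sigma_finite_measure \<mu> \<or> (\<exists>S. \<mu> = count_space S)"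
    and I: "finite I" "i \<notin> I"
    and f: "f \<in> borel_measurable (PiM (insert i I) (\<lambda>_. \<mu>))"
    and inner: "(\<lambda>x. \<integral>\<^sup>+y. f (x(i := y)) \<partial>\<mu>) \<in> borel_measurable (PiM I (\<lambda>_. \<mu>))"
  shows "(\<integral>\<^sup>+x. f x \<partial>PiM (insert i I) (\<lambda>_. \<mu>)) = (\<integral>\<^sup>+x. \<integral>\<^sup>+y. f (x(i := y)) \<partial>\<mu> \<partial>PiM I (\<lambda>_. \<mu>))"
  using base
proof
  assume "sigma_finite_measure \<mu>"
  then interpret product_sigma_finite "\<lambda>_. \<mu>"
    by (simp add: product_sigma_finite_def)
  show ?thesis
    by (rule product_nn_integral_insert[OF I f])
next
  assume "\<exists>S. \<mu> = count_space S"
  then show ?thesis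
    using nn_integral_PiM_count_space_insert[OF I] f inner by auto
qed

text \<open>Describes a single parameter value, so that it can be instantiated at the true parameter
  and at an alternative side by side.\<close>

locale density_chain =
  fixes \<mu> :: "'x measure" and q0 :: "'x \<Rightarrow> real" and p :: "'p \<Rightarrow> 'x \<Rightarrow> 'x \<Rightarrow> real" and \<theta> :: 'p
  assumes base: "sigma_finite_measure \<mu> \<or> (\<exists>S. \<mu> = count_space S)"
    and q0_measurable[measurable]: "q0 \<in> borel_measurable \<mu>"
    and q0_nonneg: "\<And>x. x \<in> space \<mu> \<Longrightarrow> 0 \<le> q0 x"
    and q0_integral: "(\<integral>\<^sup>+x. ennreal (q0 x) \<partial>\<mu>) = 1"
    and p_measurable: "(\<lambda>(y, x). p \<theta> y x) \<in> borel_measurable (\<mu> \<Otimes>\<^sub>M \<mu>)"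
    and p_nonneg: "\<And>x y. x \<in> space \<mu> \<Longrightarrow> y \<in> space \<mu> \<Longrightarrow> 0 \<le> p \<theta> y x"
    and p_integral: "\<And>x. x \<in> space \<mu> \<Longrightarrow> (\<integral>\<^sup>+y. ennreal (p \<theta> y x) \<partial>\<mu>) = 1"
begin

abbreviation "Path (n :: nat) \<equiv> PiM {0..n} (\<lambda>_. \<mu>)"
abbreviation "Law n \<equiv> pathlaw \<mu> q0 p \<theta> n"
abbreviation "Ker x \<equiv> kern \<mu> p \<theta> x"
abbreviation "Nst l x \<equiv> nstep \<mu> p \<theta> l x"

lemma p_measurable'[measurable (raw)]:
  assumes "f \<in> measurable N \<mu>" "g \<in> measurable N \<mu>"
  shows "(\<lambda>w. p \<theta> (f w) (g w)) \<in> borel_measurable N"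
  using measurable_compose[OF measurable_Pair[OF assms] p_measurable] by simp

section \<open>The transition kernel\<close>

lemma sets_Ker[simp, measurable_cong]: "sets (Ker x) = sets \<mu>"
  and space_Ker[simp]: "space (Ker x) = space \<mu>"
  by (simp_all add: kern_def)

lemma prob_space_Ker: "x \<in> space \<mu> \<Longrightarrow> prob_space (Ker x)"
  using p_integral[of x] by (auto simp: kern_def emeasure_density intro!: prob_spaceI
      cong: nn_integral_cong)

lemma emeasure_Ker_space: "x \<in> space \<mu> \<Longrightarrow> emeasure (Ker x) (space \<mu>) = 1"
  using prob_space.emeasure_space_1[OF prob_space_Ker] by simp

lemma nn_integral_Ker:
  assumes "x \<in> space \<mu>" "g \<in> borel_measurable \<mu>"
  shows "(\<integral>\<^sup>+y. g y \<partial>Ker x) = (\<integral>\<^sup>+y. ennreal (p \<theta> y x) * g y \<partial>\<mu>)"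
  using assms unfolding kern_def by (intro nn_integral_density) auto

text \<open>For sigma-finite \<open>\<mu>\<close> this is measurability of an integral depending on
  a parameter; on a counting space every map is measurable.\<close>

lemma Ker_measurable[measurable]: "kern \<mu> p \<theta> \<in> measurable \<mu> (subprob_algebra \<mu>)"
  using base
proof
  assume "sigma_finite_measure \<mu>"
  then interpret sigma_finite_measure \<mu> .
  show ?thesis
  proof (rule measurable_subprob_algebra)
    fix A assume [measurable]: "A \<in> sets \<mu>"
    have "(\<lambda>x. emeasure (Ker x) A) \<in> borel_measurable \<mu> \<longleftrightarrow>
        (\<lambda>x. \<integral>\<^sup>+y. ennreal (p \<theta> y x) * indicator A y \<partial>\<mu>) \<in> borel_measurable \<mu>"
      by (intro measurable_cong) (auto simp: kern_def emeasure_density)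
    then show "(\<lambda>x. emeasure (Ker x) A) \<in> borel_measurable \<mu>"
      by simp
  qed (auto intro: prob_space_imp_subprob_space prob_space_Ker)
next
  assume "\<exists>S. \<mu> = count_space S"
  then obtain S where S: "\<mu> = count_space S" ..
  have "kern \<mu> p \<theta> \<in> space \<mu> \<rightarrow> space (subprob_algebra \<mu>)"
    using prob_space_Ker by (auto simp: space_subprob_algebra intro: prob_space_imp_subprob_space)
  then show ?thesis
    using measurable_count_space_eq1[of "kern \<mu> p \<theta>" S "subprob_algebra \<mu>"] unfolding S by simp
qed

lemma space_nonempty: "space \<mu> \<noteq> {}"
  using q0_integral by (auto simp: nn_integral_empty)

section \<open>Path laws, built one step at a time\<close>

lemma sets_Law[simp, measurable_cong]: "sets (Law n) = sets (Path n)"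
  and space_Law[simp]: "space (Law n) = space (Path n)"
  by (simp_all add: pathlaw_def)

lemma coord_measurable[measurable (raw)]:
  "i \<le> n \<Longrightarrow> (\<lambda>xs. xs i) \<in> measurable (Path n) \<mu>"
  by (rule measurable_component_singleton) simp

lemma coord_space: "xs \<in> space (Path n) \<Longrightarrow> i \<le> n \<Longrightarrow> xs i \<in> space \<mu>"
  using PiE_mem[of xs "{0..n}" "\<lambda>_. space \<mu>" i] by (simp add: space_PiM)

lemma pathdens_measurable[measurable]: "pathdens q0 p \<theta> n \<in> borel_measurable (Path n)"
proof -
  have "(\<lambda>xs. q0 (xs 0) * (\<Prod>i\<in>{1..n}. p \<theta> (xs i) (xs (i - 1)))) \<in> borel_measurable (Path n)"
    by (intro borel_measurable_times borel_measurable_prod p_measurable'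
        measurable_compose[OF _ q0_measurable] coord_measurable) auto
  then show ?thesis
    by (simp add: pathdens_def[abs_def])
qed

lemma pathdens_nonneg: "xs \<in> space (Path n) \<Longrightarrow> 0 \<le> pathdens q0 p \<theta> n xs"
  unfolding pathdens_def
  by (intro mult_nonneg_nonneg prod_nonneg ballI p_nonneg q0_nonneg) (auto intro: coord_space)

lemma pathdens_Suc:
  "pathdens q0 p \<theta> (Suc n) (xs(Suc n := y)) = pathdens q0 p \<theta> n xs * p \<theta> y (xs n)"
proof -
  have "(\<Prod>i\<in>{1..n}. p \<theta> ((xs(Suc n := y)) i) ((xs(Suc n := y)) (i - 1)))
      = (\<Prod>i\<in>{1..n}. p \<theta> (xs i) (xs (i - 1)))"
    by (intro prod.cong) auto
  then show ?thesis
    by (simp add: pathdens_def)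
qed

lemma upd_measurable: "(\<lambda>(xs, y). xs(Suc n := y)) \<in> measurable (Path n \<Otimes>\<^sub>M \<mu>) (Path (Suc n))"
  unfolding atLeast0_atMost_Suc by (rule measurable_add_dim)

lemma upd_measurable2:
  assumes "xs \<in> space (Path n)" shows "(\<lambda>y. xs(Suc n := y)) \<in> measurable \<mu> (Path (Suc n))"
  using measurable_compose[OF measurable_Pair1'[OF assms] upd_measurable] by simp

lemma Ker_upd_measurable:
  fixes g :: "_ \<Rightarrow> ennreal"
  assumes "g \<in> borel_measurable (Path (Suc n))"
  shows "(\<lambda>xs. \<integral>\<^sup>+y. g (xs(Suc n := y)) \<partial>Ker (xs n)) \<in> borel_measurable (Path n)"
  using measurable_compose[OF upd_measurable assms]
  by (intro nn_integral_measurable_subprob_algebra2[where N=\<mu>]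
      measurable_compose[OF _ Ker_measurable] coord_measurable)
    (auto simp: case_prod_beta')

text \<open>The path density gains the factor \<open>p \<theta> y (xs n)\<close> with each step, so
  integrating out the last coordinate against \<open>\<mu>\<close> turns this factor into the
  kernel.\<close>

lemma nn_integral_Law_Suc:
  assumes g: "g \<in> borel_measurable (Path (Suc n))"
  shows "(\<integral>\<^sup>+xs. g xs \<partial>Law (Suc n)) = (\<integral>\<^sup>+xs. \<integral>\<^sup>+y. g (xs(Suc n := y)) \<partial>Ker (xs n) \<partial>Law n)"
proof -
  let ?f = "\<lambda>xs. ennreal (pathdens q0 p \<theta> (Suc n) xs) * g xs"
  have inner: "(\<integral>\<^sup>+y. ?f (xs(Suc n := y)) \<partial>\<mu>) =
      ennreal (pathdens q0 p \<theta> n xs) * (\<integral>\<^sup>+y. g (xs(Suc n := y)) \<partial>Ker (xs n))" if xs: "xs \<in> space (Path n)" for xs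
  proof -
    have [measurable]: "(\<lambda>y. g (xs(Suc n := y))) \<in> borel_measurable \<mu>"
      using measurable_compose[OF upd_measurable2[OF xs] g] .
    have [measurable]: "xs n \<in> space \<mu>"
      using coord_space[OF xs] by simp
    have "(\<integral>\<^sup>+y. ?f (xs(Suc n := y)) \<partial>\<mu>) =
        (\<integral>\<^sup>+y. ennreal (pathdens q0 p \<theta> n xs) * (ennreal (p \<theta> y (xs n)) * g (xs(Suc n := y))) \<partial>\<mu>)"
      using pathdens_nonneg[OF xs] p_nonneg[OF \<open>xs n \<in> space \<mu>\<close>]
      by (intro nn_integral_cong) (simp add: pathdens_Suc ennreal_mult mult.assoc)
    also have "\<dots> = ennreal (pathdens q0 p \<theta> n xs) * (\<integral>\<^sup>+y. g (xs(Suc n := y)) \<partial>Ker (xs n))"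
      by (subst nn_integral_cmult) (simp_all add: nn_integral_Ker[OF \<open>xs n \<in> space \<mu>\<close>])
    finally show ?thesis .
  qed
  note [measurable] = Ker_upd_measurable[OF g]
  have "(\<integral>\<^sup>+xs. g xs \<partial>Law (Suc n)) = (\<integral>\<^sup>+xs. ?f xs \<partial>Path (Suc n))"
    unfolding pathlaw_def using g by (intro nn_integral_density) auto
  also have "\<dots> = (\<integral>\<^sup>+xs. \<integral>\<^sup>+y. ?f (xs(Suc n := y)) \<partial>\<mu> \<partial>Path n)"
    unfolding atLeast0_atMost_Suc
  proof (rule nn_integral_PiM_insert[OF base])
    show "?f \<in> borel_measurable (PiM (insert (Suc n) {0..n}) (\<lambda>_. \<mu>))"
      using g unfolding atLeast0_atMost_Suc[symmetric] by measurable
    show "(\<lambda>xs. \<integral>\<^sup>+y. ?f (xs(Suc n := y)) \<partial>\<mu>) \<in> borel_measurable (Path n)"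
      by (subst measurable_cong[OF inner]) auto
  qed auto
  also have "\<dots> = (\<integral>\<^sup>+xs. ennreal (pathdens q0 p \<theta> n xs) * (\<integral>\<^sup>+y. g (xs(Suc n := y)) \<partial>Ker (xs n)) \<partial>Path n)"
    by (intro nn_integral_cong inner)
  also have "\<dots> = (\<integral>\<^sup>+xs. \<integral>\<^sup>+y. g (xs(Suc n := y)) \<partial>Ker (xs n) \<partial>Law n)"
    unfolding pathlaw_def by (intro nn_integral_density[symmetric]) auto
  finally show ?thesis .
qed

lemma nn_integral_Law_0:
  assumes g[measurable]: "g \<in> borel_measurable \<mu>"
  shows "(\<integral>\<^sup>+xs. g (xs 0) \<partial>Law 0) = (\<integral>\<^sup>+x. ennreal (q0 x) * g x \<partial>\<mu>)"
proof -
  have [measurable]: "(\<lambda>xs. xs 0) \<in> measurable (PiM {0 :: nat} (\<lambda>_. \<mu>)) \<mu>"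
    by simp
  have "(\<integral>\<^sup>+xs. g (xs 0) \<partial>Law 0) = (\<integral>\<^sup>+xs. ennreal (q0 (xs 0)) * g (xs 0) \<partial>PiM (insert (0 :: nat) {}) (\<lambda>_. \<mu>))"
    unfolding pathlaw_def by (subst nn_integral_density) (auto simp: pathdens_def)
  also have "\<dots> = (\<integral>\<^sup>+xs. \<integral>\<^sup>+y. ennreal (q0 ((xs(0 := y)) 0)) * g ((xs(0 := y)) 0) \<partial>\<mu> \<partial>PiM ({} :: nat set) (\<lambda>_. \<mu>))"
    by (rule nn_integral_PiM_insert[OF base]) auto
  also have "\<dots> = (\<integral>\<^sup>+x. ennreal (q0 x) * g x \<partial>\<mu>)"
    by (simp add: PiM_empty nn_integral_count_space_finite)
  finally show ?thesis .
qed

text \<open>\<open>upd\<close> expresses that \<open>g\<close> ignores the coordinate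
  \<open>Suc n\<close>; the last kernel then integrates a constant and has mass one. Measurability
  is asked twice because the two path spaces carry different sigma-algebras.\<close>

lemma nn_integral_Law_Suc_initial:
  assumes g: "g \<in> borel_measurable (Path n)" and upd: "\<And>xs y. g (xs(Suc n := y)) = g xs"
    and g': "g \<in> borel_measurable (Path (Suc n))"
  shows "(\<integral>\<^sup>+xs. g xs \<partial>Law (Suc n)) = (\<integral>\<^sup>+xs. g xs \<partial>Law n)"
  unfolding nn_integral_Law_Suc[OF g'] upd
  by (intro nn_integral_cong)
    (simp add: emeasure_Ker_space coord_space)

lemma prob_space_Law: "prob_space (Law n)"
proof (rule prob_spaceI)
  have "(\<integral>\<^sup>+xs. 1 \<partial>Law n) = 1"
  proof (induction n)
    case 0
    have "(\<integral>\<^sup>+xs. 1 \<partial>Law 0) = (\<integral>\<^sup>+x. ennreal (q0 x) * 1 \<partial>\<mu>)"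
      by (rule nn_integral_Law_0) simp
    then show ?case
      by (simp only: mult_1_right q0_integral)
  next
    case (Suc n)
    have "(\<integral>\<^sup>+xs. 1 \<partial>Law (Suc n)) = (\<integral>\<^sup>+xs. 1 \<partial>Law n)"
      by (rule nn_integral_Law_Suc_initial) simp_all
    then show ?case
      by (simp only: Suc)
  qed
  then show "emeasure (Law n) (space (Law n)) = 1"
    by (simp only: nn_integral_const mult_1)
qed

lemma integral_Law_Suc:
  fixes g :: "_ \<Rightarrow> real"
  assumes g: "integrable (Law (Suc n)) g"
  shows "integrable (Law n) (\<lambda>xs. \<integral>y. g (xs(Suc n := y)) \<partial>Ker (xs n))"
    and "(\<integral>xs. g xs \<partial>Law (Suc n)) = (\<integral>xs. \<integral>y. g (xs(Suc n := y)) \<partial>Ker (xs n) \<partial>Law n)"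
proof -
  have nn: "(\<integral>\<^sup>+xs. h xs \<partial>Law (Suc n)) = (\<integral>\<^sup>+xs. \<integral>\<^sup>+y. h (xs(Suc n := y)) \<partial>Ker (xs n) \<partial>Law n)"
    and meas: "(\<lambda>xs. \<integral>\<^sup>+y. h (xs(Suc n := y)) \<partial>Ker (xs n)) \<in> borel_measurable (Law n)"
    if "h \<in> borel_measurable (Law (Suc n))" for h :: "_ \<Rightarrow> ennreal"
    using that unfolding measurable_cong_sets[OF sets_Law refl]
    by (fact nn_integral_Law_Suc Ker_upd_measurable)+
  have upd: "(\<lambda>y. xs(Suc n := y)) \<in> measurable (Ker (xs n)) (Law (Suc n))" if "xs \<in> space (Law n)" for xs
    using that unfolding measurable_cong_sets[OF sets_Ker sets_Law] space_Law by (rule upd_measurable2)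
  note disint = integral_disintegration[where \<phi>="\<lambda>xs y. xs(Suc n := y)" and K="\<lambda>xs. Ker (xs n)"
      and Q="Law n" and Q'="Law (Suc n)" and g=g]
  show "integrable (Law n) (\<lambda>xs. \<integral>y. g (xs(Suc n := y)) \<partial>Ker (xs n))"
    by (rule disint(1)) (fact nn meas upd g)+
  show "(\<integral>xs. g xs \<partial>Law (Suc n)) = (\<integral>xs. \<integral>y. g (xs(Suc n := y)) \<partial>Ker (xs n) \<partial>Law n)"
    by (rule disint(2)) (fact nn meas upd g)+
qed

section \<open>Iterated kernels, marginals and the Markov property\<close>

lemma sets_Nst[measurable_cong]: "x \<in> space \<mu> \<Longrightarrow> sets (Nst l x) = sets \<mu>"
proof (induction l)
  case (Suc l)
  \<comment> \<open>On an empty space \<open>bind\<close> is a degenerate measure, so its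
    sigma-algebra can be read off only once this is excluded.\<close>
  then have "space (Nst l x) \<noteq> {}"
    using sets_eq_imp_space_eq[of "Nst l x" \<mu>] space_nonempty by simp
  then show ?case
    by (simp add: sets_bind[where N=\<mu>])
qed simp

lemma space_Nst: "x \<in> space \<mu> \<Longrightarrow> space (Nst l x) = space \<mu>"
  using sets_Nst sets_eq_imp_space_eq by blast

lemma nn_integral_Nst_Suc:
  assumes x: "x \<in> space \<mu>" and g: "g \<in> borel_measurable \<mu>"
  shows "(\<integral>\<^sup>+y. g y \<partial>Nst (Suc l) x) = (\<integral>\<^sup>+z. \<integral>\<^sup>+y. g y \<partial>Ker z \<partial>Nst l x)"
  using Ker_measurable by (auto intro!: nn_integral_bind[OF g] simp: measurable_cong_sets[OF sets_Nst[OF x] refl])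

lemma Ker_measurable2:
  fixes g :: "'x \<Rightarrow> ennreal"
  assumes "g \<in> borel_measurable \<mu>"
  shows "(\<lambda>x. \<integral>\<^sup>+y. g y \<partial>Ker x) \<in> borel_measurable \<mu>"
  using assms by (intro nn_integral_measurable_subprob_algebra2[where N=\<mu>] Ker_measurable) auto

lemma integral_Nst_Suc:
  fixes g :: "_ \<Rightarrow> real"
  assumes x: "x \<in> space \<mu>" and g: "integrable (Nst (Suc l) x) g"
  shows "integrable (Nst l x) (\<lambda>z. \<integral>y. g y \<partial>Ker z)"
    and "(\<integral>y. g y \<partial>Nst (Suc l) x) = (\<integral>z. \<integral>y. g y \<partial>Ker z \<partial>Nst l x)"
proof -
  have nn: "(\<integral>\<^sup>+y. h y \<partial>Nst (Suc l) x) = (\<integral>\<^sup>+z. \<integral>\<^sup>+y. h y \<partial>Ker z \<partial>Nst l x)"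
    and meas: "(\<lambda>z. \<integral>\<^sup>+y. h y \<partial>Ker z) \<in> borel_measurable (Nst l x)"
    if "h \<in> borel_measurable (Nst (Suc l) x)" for h :: "_ \<Rightarrow> ennreal"
    using that nn_integral_Nst_Suc[OF x] Ker_measurable2
    by (simp_all add: measurable_cong_sets[OF sets_Nst[OF x] refl] del: nstep.simps)
  have id: "(\<lambda>y. y) \<in> measurable (Ker z) (Nst (Suc l) x)" for z
    by (simp add: measurable_cong_sets[OF sets_Ker sets_Nst[OF x]] del: nstep.simps)
  note disint = integral_disintegration[where \<phi>="\<lambda>z y. y" and K="kern \<mu> p \<theta>"
      and Q="Nst l x" and Q'="Nst (Suc l) x" and g=g]
  show "integrable (Nst l x) (\<lambda>z. \<integral>y. g y \<partial>Ker z)"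
    by (rule disint(1)) (fact nn | fact meas | rule id | rule g)+
  show "(\<integral>y. g y \<partial>Nst (Suc l) x) = (\<integral>z. \<integral>y. g y \<partial>Ker z \<partial>Nst l x)"
    by (rule disint(2)) (fact nn | fact meas | rule id | rule g)+
qed

lemma prob_space_Nst:
  assumes x: "x \<in> space \<mu>" shows "prob_space (Nst l x)"
proof (rule prob_spaceI)
  have "(\<integral>\<^sup>+y. 1 \<partial>Nst l x) = 1"
  proof (induction l)
    case 0
    show ?case
      using x by (simp add: nn_integral_return)
  next
    case (Suc l)
    have "(\<integral>\<^sup>+y. 1 \<partial>Nst (Suc l) x) = (\<integral>\<^sup>+z. \<integral>\<^sup>+y. 1 \<partial>Ker z \<partial>Nst l x)"
      by (rule nn_integral_Nst_Suc[OF x]) simp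
    also have "\<dots> = (\<integral>\<^sup>+z. 1 \<partial>Nst l x)"
      using x by (intro nn_integral_cong)
        (simp add: emeasure_Ker_space space_Nst)
    finally show ?case
      using Suc by simp
  qed
  then show "emeasure (Nst l x) (space (Nst l x)) = 1"
    by simp
qed

text \<open>Induction removes the last step: conditioning replaces \<open>g\<close> by its kernel
  average, evaluated one time unit earlier. Hence the generalisation over \<open>g\<close>.\<close>

lemma nn_integral_Law_marginal:
  assumes "g \<in> borel_measurable \<mu>"
  shows "(\<integral>\<^sup>+xs. g (xs n) \<partial>Law n) = (\<integral>\<^sup>+x. ennreal (q0 x) * (\<integral>\<^sup>+y. g y \<partial>Nst n x) \<partial>\<mu>)"
  using assms
proof (induction n arbitrary: g)
  case 0
  have "(\<integral>\<^sup>+x. ennreal (q0 x) * (\<integral>\<^sup>+y. g y \<partial>Nst 0 x) \<partial>\<mu>) = (\<integral>\<^sup>+x. ennreal (q0 x) * g x \<partial>\<mu>)"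
    using 0 by (intro nn_integral_cong) (simp add: nn_integral_return)
  then show ?case
    using nn_integral_Law_0[OF 0] by simp
next
  case (Suc n)
  have "(\<integral>\<^sup>+xs. g (xs (Suc n)) \<partial>Law (Suc n)) = (\<integral>\<^sup>+xs. \<integral>\<^sup>+y. g y \<partial>Ker (xs n) \<partial>Law n)"
    using measurable_compose[OF coord_measurable[of "Suc n"] Suc.prems]
    by (subst nn_integral_Law_Suc) auto
  also have "\<dots> = (\<integral>\<^sup>+x. ennreal (q0 x) * (\<integral>\<^sup>+z. \<integral>\<^sup>+y. g y \<partial>Ker z \<partial>Nst n x) \<partial>\<mu>)"
    by (rule Suc.IH[OF Ker_measurable2[OF Suc.prems]])
  also have "\<dots> = (\<integral>\<^sup>+x. ennreal (q0 x) * (\<integral>\<^sup>+y. g y \<partial>Nst (Suc n) x) \<partial>\<mu>)"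
    by (intro nn_integral_cong arg_cong2[where f="(*)"] refl nn_integral_Nst_Suc[symmetric] Suc.prems)
  finally show ?case .
qed

text \<open>The Markov property for a weight \<open>W\<close> of the path up to time
  \<open>i\<close>, which is what \<open>upd\<close> expresses. Each of the \<open>l\<close> steps
  replaces \<open>G\<close> by its kernel average; integrability of \<open>G\<close> is required
  under all n-step laws so that the hypothesis passes on to this average.\<close>

lemma integral_Law_markov:
  fixes G :: "'x \<Rightarrow> real"
  assumes "G \<in> borel_measurable \<mu>"
    and "\<And>x k. x \<in> space \<mu> \<Longrightarrow> integrable (Nst k x) G"
    and upd: "\<And>xs j y. i < j \<Longrightarrow> W (xs(j := y)) = W xs"
    and "integrable (Law (i + l)) (\<lambda>xs. W xs * G (xs (i + l)))"
  shows "integrable (Law i) (\<lambda>xs. W xs * (\<integral>y. G y \<partial>Nst l (xs i))) \<and>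
    (\<integral>xs. W xs * G (xs (i + l)) \<partial>Law (i + l)) = (\<integral>xs. W xs * (\<integral>y. G y \<partial>Nst l (xs i)) \<partial>Law i)"
  using assms(1,2,4)
proof (induction l arbitrary: G)
  case 0
  have eq: "W xs * (\<integral>y. G y \<partial>Nst 0 (xs i)) = W xs * G (xs i)" if "xs \<in> space (Law i)" for xs
    using 0(1) coord_space[of xs i i] that by (simp add: integral_return[of _ \<mu> G])
  have "integrable (Law i) (\<lambda>xs. W xs * (\<integral>y. G y \<partial>Nst 0 (xs i))) \<longleftrightarrow> integrable (Law i) (\<lambda>xs. W xs * G (xs i))"
    by (intro Bochner_Integration.integrable_cong refl eq) simp
  moreover have "(\<integral>xs. W xs * (\<integral>y. G y \<partial>Nst 0 (xs i)) \<partial>Law i) = (\<integral>xs. W xs * G (xs i) \<partial>Law i)"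
    by (intro Bochner_Integration.integral_cong refl eq) simp
  ultimately show ?case
    using 0(3) by (simp del: nstep.simps)
next
  case (Suc l)
  define PG where "PG z = (\<integral>y. G y \<partial>Ker z)" for z
  have Suc_eq: "integrable (Nst k x) PG" "(\<integral>y. G y \<partial>Nst (Suc k) x) = (\<integral>y. PG y \<partial>Nst k x)"
    if "x \<in> space \<mu>" for k x
    using integral_Nst_Suc[OF that Suc.prems(2)[OF that, of "Suc k"]] by (simp_all add: PG_def[abs_def] del: nstep.simps)
  have PG_meas: "PG \<in> borel_measurable \<mu>"
  proof -
    obtain x where x: "x \<in> space \<mu>"
      using space_nonempty by auto
    \<comment> \<open>Integrability at \<open>k = 0\<close> refers to a point mass that carries the
      sets of \<open>\<mu>\<close>, so it already contains measurability.\<close>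
    have "PG \<in> borel_measurable (Nst 0 x)"
      using Suc_eq(1)[OF x] by blast
    then show ?thesis
      by (simp add: measurable_cong_sets[OF sets_return refl])
  qed
  have step: "(\<integral>y. W (xs(Suc (i + l) := y)) * G ((xs(Suc (i + l) := y)) (Suc (i + l))) \<partial>Ker (xs (i + l)))
      = W xs * PG (xs (i + l))" for xs
    by (simp add: upd PG_def)
  have int: "integrable (Law (Suc (i + l))) (\<lambda>xs. W xs * G (xs (Suc (i + l))))"
    using Suc.prems(3) by simp
  have 1: "integrable (Law (i + l)) (\<lambda>xs. W xs * PG (xs (i + l)))"
    using integral_Law_Suc(1)[OF int] unfolding step .
  have 2: "(\<integral>xs. W xs * G (xs (Suc (i + l))) \<partial>Law (Suc (i + l))) = (\<integral>xs. W xs * PG (xs (i + l)) \<partial>Law (i + l))"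
    using integral_Law_Suc(2)[OF int] unfolding step .
  note IH = Suc.IH[OF PG_meas Suc_eq(1) 1]
  have eq: "W xs * (\<integral>y. G y \<partial>Nst (Suc l) (xs i)) = W xs * (\<integral>y. PG y \<partial>Nst l (xs i))"
    if "xs \<in> space (Law i)" for xs
    using that Suc_eq(2)[OF coord_space[of xs i i]] by (simp del: nstep.simps)
  have "integrable (Law i) (\<lambda>xs. W xs * (\<integral>y. G y \<partial>Nst (Suc l) (xs i))) \<longleftrightarrow>
      integrable (Law i) (\<lambda>xs. W xs * (\<integral>y. PG y \<partial>Nst l (xs i)))"
    by (intro Bochner_Integration.integrable_cong refl eq) simp
  moreover have "(\<integral>xs. W xs * (\<integral>y. G y \<partial>Nst (Suc l) (xs i)) \<partial>Law i) = (\<integral>xs. W xs * (\<integral>y. PG y \<partial>Nst l (xs i)) \<partial>Law i)"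
    by (intro Bochner_Integration.integral_cong refl eq) simp
  ultimately show ?case
    using IH 2 by (simp del: nstep.simps)
qed

end

section \<open>Geometric ergodicity\<close>

lemma abs_mult_le_half_squares: "\<bar>a * b\<bar> \<le> (a\<^sup>2 + b\<^sup>2) / (2 :: real)"
  using sum_squares_bound[of "\<bar>a\<bar>" "\<bar>b\<bar>"] by (simp add: abs_mult)

lemma integrable_mult_of_squares:
  fixes f g :: "'a \<Rightarrow> real"
  assumes [measurable]: "f \<in> borel_measurable M" "g \<in> borel_measurable M"
    and "integrable M (\<lambda>x. (f x)\<^sup>2)" "integrable M (\<lambda>x. (g x)\<^sup>2)"
  shows "integrable M (\<lambda>x. f x * g x)"
proof (rule Bochner_Integration.integrable_bound)
  show "integrable M (\<lambda>x. ((f x)\<^sup>2 + (g x)\<^sup>2) / 2)"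
    using assms by auto
  show "AE x in M. norm (f x * g x) \<le> norm (((f x)\<^sup>2 + (g x)\<^sup>2) / 2)"
    using abs_mult_le_half_squares by (auto intro!: AE_I2 order_trans[OF abs_mult_le_half_squares])
qed measurable

locale ergodic_chain = density_chain +
  fixes V q :: "'a \<Rightarrow> real" and R \<tau> :: real
  assumes V_measurable[measurable]: "V \<in> borel_measurable \<mu>"
    and V_ge_1: "\<And>x. x \<in> space \<mu> \<Longrightarrow> 1 \<le> V x"
    and q_measurable[measurable]: "q \<in> borel_measurable \<mu>"
    and q_nonneg: "\<And>x. x \<in> space \<mu> \<Longrightarrow> 0 \<le> q x"
    and q_prob: "(\<integral>\<^sup>+x. ennreal (q x) \<partial>\<mu>) = 1"
    and V_q: "(\<integral>\<^sup>+x. ennreal (V x * q x) \<partial>\<mu>) < \<infinity>"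
    and tau: "0 < \<tau>" "\<tau> < 1"
    and geom: "V_geom_ergodic \<mu> p \<theta> V q R \<tau>"
    and V_init: "(\<integral>\<^sup>+x. ennreal (V x * q0 x) \<partial>\<mu>) < \<infinity>"
begin

text \<open>\<open>mean_V\<close> will bound the mean of \<open>V (xs n)\<close> for every
  \<open>n\<close>: started from \<open>x\<close>, this mean is at most
  \<open>stat_V + \<bar>R\<bar> * V x\<close>, which is then integrated against \<open>q0\<close>.
  The absolute value is taken because the locale states no sign for \<open>R\<close>.\<close>

definition "stat_V = (\<integral>x. V x * q x \<partial>\<mu>)"
definition "init_V = (\<integral>x. V x * q0 x \<partial>\<mu>)"
definition "mean_V = stat_V + \<bar>R\<bar> * init_V"

lemma V_nonneg: "x \<in> space \<mu> \<Longrightarrow> 0 \<le> V x"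
  using V_ge_1 by force

lemma integrable_q: "integrable \<mu> q" and integral_q: "(\<integral>x. q x \<partial>\<mu>) = 1"
  using q_prob q_nonneg by (auto intro!: integrableI_nonneg simp: integral_eq_nn_integral)

lemma integrable_V_q: "integrable \<mu> (\<lambda>x. V x * q x)"
  using V_q q_nonneg V_nonneg by (intro integrableI_nonneg) auto

lemma integrable_V_q0: "integrable \<mu> (\<lambda>x. V x * q0 x)"
  using V_init q0_nonneg V_nonneg by (intro integrableI_nonneg) auto

lemma integrable_q0: "integrable \<mu> q0" and integral_q0: "(\<integral>x. q0 x \<partial>\<mu>) = 1"
  using q0_integral q0_nonneg by (auto intro!: integrableI_nonneg simp: integral_eq_nn_integral)

lemma stat_V_ge_1: "1 \<le> stat_V"
proof -
  have "(\<integral>x. q x \<partial>\<mu>) \<le> stat_V"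
    unfolding stat_V_def using mult_right_mono[OF V_ge_1 q_nonneg]
    by (intro integral_mono integrable_q integrable_V_q) simp
  then show ?thesis
    by (simp add: integral_q)
qed

lemma init_V_nonneg: "0 \<le> init_V"
  unfolding init_V_def using V_nonneg q0_nonneg by (intro integral_nonneg_AE AE_I2) simp

lemma mean_V_ge_1: "1 \<le> mean_V"
  unfolding mean_V_def using stat_V_ge_1 init_V_nonneg by (simp add: add_increasing2)

lemma integrable_Nst_V: "x \<in> space \<mu> \<Longrightarrow> integrable (Nst l x) V"
  using geom by (auto simp: V_geom_ergodic_def)

lemma integrable_Nst:
  assumes "x \<in> space \<mu>" and [measurable]: "g \<in> borel_measurable \<mu>" and "\<And>y. y \<in> space \<mu> \<Longrightarrow> \<bar>g y\<bar> \<le> c * V y"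
  shows "integrable (Nst l x) g"
proof (rule Bochner_Integration.integrable_bound)
  show "integrable (Nst l x) (\<lambda>y. c * V y)"
    using integrable_Nst_V[OF assms(1)] by simp
  show "g \<in> borel_measurable (Nst l x)"
    by (simp add: measurable_cong_sets[OF sets_Nst[OF assms(1)] refl])
  show "AE y in Nst l x. norm (g y) \<le> norm (c * V y)"
    using assms(3) by (intro AE_I2) (force simp: space_Nst[OF assms(1)])
qed

lemma integrable_stat:
  assumes [measurable]: "g \<in> borel_measurable \<mu>" and "\<And>y. y \<in> space \<mu> \<Longrightarrow> \<bar>g y\<bar> \<le> c * V y"
  shows "integrable \<mu> (\<lambda>y. g y * q y)"
proof (rule Bochner_Integration.integrable_bound)
  show "integrable \<mu> (\<lambda>y. c * (V y * q y))"
    using integrable_V_q by simp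
  show "AE y in \<mu>. norm (g y * q y) \<le> norm (c * (V y * q y))"
  proof (intro AE_I2)
    fix y assume "y \<in> space \<mu>"
    then have "\<bar>g y\<bar> \<le> \<bar>c * V y\<bar>"
      using assms(2) by force
    then show "norm (g y * q y) \<le> norm (c * (V y * q y))"
      by (simp add: abs_mult mult.assoc[symmetric] mult_right_mono)
  qed
qed simp

text \<open>By homogeneity the ergodicity bound is applied to \<open>g / c\<close>. For
  \<open>c = 0\<close> the function vanishes on the state space and both integrals are zero.\<close>

lemma geometric:
  assumes x: "x \<in> space \<mu>" and g[measurable]: "g \<in> borel_measurable \<mu>"
    and bound: "\<And>y. y \<in> space \<mu> \<Longrightarrow> \<bar>g y\<bar> \<le> c * V y" and c: "0 \<le> c"
  shows "\<bar>(\<integral>y. g y \<partial>Nst l x) - (\<integral>y. g y * q y \<partial>\<mu>)\<bar> \<le> c * \<bar>R\<bar> * V x * \<tau> ^ l"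
proof (cases "c = 0")
  case True
  then have zero: "g y = 0" if "y \<in> space \<mu>" for y
    using bound[OF that] by simp
  have "(\<integral>y. g y \<partial>Nst l x) = (\<integral>y. 0 \<partial>Nst l x)"
    by (intro Bochner_Integration.integral_cong refl zero) (simp add: space_Nst[OF x])
  moreover have "(\<integral>y. g y * q y \<partial>\<mu>) = (\<integral>y. 0 \<partial>\<mu>)"
    by (intro Bochner_Integration.integral_cong refl) (simp add: zero)
  ultimately show ?thesis
    using True by simp
next
  case False
  with c have "0 < c" by simp
  have meas: "(\<lambda>y. g y / c) \<in> borel_measurable \<mu>"
    by measurable
  have bd: "\<forall>y\<in>space \<mu>. \<bar>g y / c\<bar> \<le> V y"
    using bound \<open>0 < c\<close> by (simp add: pos_divide_le_eq mult.commute abs_divide)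
  have "\<bar>(\<integral>y. g y / c \<partial>Nst l x) - (\<integral>y. g y / c * q y \<partial>\<mu>)\<bar> \<le> R * V x * \<tau> ^ l"
    using geom[unfolded V_geom_ergodic_def, THEN bspec, OF x, THEN spec[of _ l], THEN conjunct2, THEN bspec, OF meas] bd
    by (rule mp)
  also have "\<dots> \<le> \<bar>R\<bar> * V x * \<tau> ^ l"
    using V_nonneg[OF x] tau by (intro mult_right_mono) auto
  finally have "\<bar>((\<integral>y. g y \<partial>Nst l x) - (\<integral>y. g y * q y \<partial>\<mu>)) / c\<bar> \<le> \<bar>R\<bar> * V x * \<tau> ^ l"
    by (simp add: diff_divide_distrib)
  then show ?thesis
    using \<open>0 < c\<close> by (simp add: abs_divide pos_divide_le_eq mult_ac)
qed

lemma integral_Nst_V: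
  assumes x: "x \<in> space \<mu>"
  shows "(\<integral>y. V y \<partial>Nst l x) \<le> stat_V + \<bar>R\<bar> * V x"
proof -
  have "\<bar>(\<integral>y. V y \<partial>Nst l x) - stat_V\<bar> \<le> 1 * \<bar>R\<bar> * V x * \<tau> ^ l"
    unfolding stat_V_def using V_nonneg by (intro geometric x) auto
  also have "\<dots> \<le> \<bar>R\<bar> * V x"
    using V_nonneg[OF x] tau by (simp add: mult_left_le power_le_one)
  finally show ?thesis
    by linarith
qed

lemma nn_integral_V: "(\<integral>\<^sup>+xs. ennreal (V (xs n)) \<partial>Law n) \<le> ennreal mean_V"
proof -
  have "(\<integral>\<^sup>+xs. ennreal (V (xs n)) \<partial>Law n) = (\<integral>\<^sup>+x. ennreal (q0 x) * (\<integral>\<^sup>+y. ennreal (V y) \<partial>Nst n x) \<partial>\<mu>)"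
    by (rule nn_integral_Law_marginal) simp
  also have "\<dots> \<le> (\<integral>\<^sup>+x. ennreal (stat_V * q0 x + \<bar>R\<bar> * (V x * q0 x)) \<partial>\<mu>)"
  proof (rule nn_integral_mono)
    fix x assume x: "x \<in> space \<mu>"
    have "(\<integral>\<^sup>+y. ennreal (V y) \<partial>Nst n x) = ennreal (\<integral>y. V y \<partial>Nst n x)"
      using integrable_Nst_V[OF x] V_nonneg
      by (intro nn_integral_eq_integral AE_I2) (auto simp: space_Nst[OF x])
    also have "\<dots> \<le> ennreal (stat_V + \<bar>R\<bar> * V x)"
      by (rule ennreal_leI[OF integral_Nst_V[OF x]])
    finally have "ennreal (q0 x) * (\<integral>\<^sup>+y. ennreal (V y) \<partial>Nst n x) \<le> ennreal (q0 x) * ennreal (stat_V + \<bar>R\<bar> * V x)"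
      by (rule mult_left_mono) simp
    also have "\<dots> = ennreal (q0 x * (stat_V + \<bar>R\<bar> * V x))"
      using q0_nonneg[OF x] V_nonneg[OF x] stat_V_ge_1 by (intro ennreal_mult[symmetric]) auto
    also have "q0 x * (stat_V + \<bar>R\<bar> * V x) = stat_V * q0 x + \<bar>R\<bar> * (V x * q0 x)"
      by (simp add: algebra_simps)
    finally show "ennreal (q0 x) * (\<integral>\<^sup>+y. ennreal (V y) \<partial>Nst n x) \<le> ennreal (stat_V * q0 x + \<bar>R\<bar> * (V x * q0 x))" .
  qed
  also have "\<dots> = ennreal (\<integral>x. stat_V * q0 x + \<bar>R\<bar> * (V x * q0 x) \<partial>\<mu>)"
    using integrable_q0 integrable_V_q0 q0_nonneg V_nonneg stat_V_ge_1
    by (intro nn_integral_eq_integral AE_I2) auto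
  also have "\<dots> = ennreal mean_V"
    using integrable_q0 integrable_V_q0 by (simp add: mean_V_def integral_q0 init_V_def)
  finally show ?thesis .
qed

text \<open>The bound \<open>sqrt V \<le> V\<close> and \<open>geometric\<close> would give an error
  proportional to \<open>V x\<close>; the covariances need one that grows only like
  \<open>sqrt (V x)\<close>. The level \<open>t\<close> balances two errors: the part below it costs
  \<open>2 * (a * t)\<close> by its size alone, and the part above it costs
  \<open>a / t * \<bar>R\<bar> * V x * \<tau> ^ l\<close> by ergodicity. Both are of order
  \<open>a * t\<close> when \<open>t\<^sup>2 = V x * \<tau> ^ l\<close>, whence the rate
  \<open>sqrt \<tau>\<close>.\<close>

lemma geometric_sqrt:
  assumes x: "x \<in> space \<mu>" and h[measurable]: "h \<in> borel_measurable \<mu>"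
    and bound: "\<And>y. y \<in> space \<mu> \<Longrightarrow> \<bar>h y\<bar> \<le> a * sqrt (V y)" and a: "0 \<le> a"
  shows "\<bar>(\<integral>y. h y \<partial>Nst l x) - (\<integral>y. h y * q y \<partial>\<mu>)\<bar> \<le> (2 + \<bar>R\<bar>) * (a * sqrt (V x)) * sqrt \<tau> ^ l"
proof -
  \<comment> \<open>Truncate \<open>h\<close> where \<open>sqrt V\<close> exceeds \<open>t\<close>; above the level, \<open>sqrt V \<le> V / t\<close>.\<close>
  define t where "t = sqrt (V x * \<tau> ^ l)"
  define h1 where "h1 y = (if sqrt (V y) \<le> t then h y else 0)" for y
  define h2 where "h2 y = (if sqrt (V y) \<le> t then 0 else h y)" for y
  have [measurable]: "h1 \<in> borel_measurable \<mu>" "h2 \<in> borel_measurable \<mu>"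
    unfolding h1_def h2_def by measurable
  have "0 < t" and t2: "t\<^sup>2 = V x * \<tau> ^ l"
    using V_ge_1[OF x] tau by (auto simp: t_def)
  have h1: "\<bar>h1 y\<bar> \<le> a * t" if "y \<in> space \<mu>" for y
    using bound[OF that] a \<open>0 < t\<close> mult_left_mono[of "sqrt (V y)" t a] by (auto simp: h1_def)
  have h2: "\<bar>h2 y\<bar> \<le> a / t * V y" if y: "y \<in> space \<mu>" for y
  proof (cases "sqrt (V y) \<le> t")
    case True
    then show ?thesis
      using a \<open>0 < t\<close> V_nonneg[OF y] by (simp add: h2_def)
  next
    case False
    then have "t * sqrt (V y) \<le> sqrt (V y) * sqrt (V y)"
      using V_nonneg[OF y] by (intro mult_right_mono) auto
    then have "sqrt (V y) \<le> V y / t"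
      using V_nonneg[OF y] \<open>0 < t\<close> by (simp add: pos_le_divide_eq mult.commute)
    then have "a * sqrt (V y) \<le> a * (V y / t)"
      using a by (rule mult_left_mono)
    then show ?thesis
      using bound[OF y] False by (simp add: h2_def)
  qed
  have h1': "\<bar>h1 y\<bar> \<le> a * t * V y" if "y \<in> space \<mu>" for y
    using h1[OF that] mult_left_mono[OF V_ge_1[OF that], of "a * t"] a \<open>0 < t\<close> by simp
  have split: "h y = h1 y + h2 y" for y
    by (simp add: h1_def h2_def)
  interpret N: prob_space "Nst l x"
    by (rule prob_space_Nst[OF x])
  have int_N: "integrable (Nst l x) h1" "integrable (Nst l x) h2"
    using integrable_Nst[OF x _ h1'] integrable_Nst[OF x _ h2] by auto
  have int_q: "integrable \<mu> (\<lambda>y. h1 y * q y)" "integrable \<mu> (\<lambda>y. h2 y * q y)"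
    using integrable_stat[OF _ h1'] integrable_stat[OF _ h2] by auto
  have "\<bar>\<integral>y. h1 y \<partial>Nst l x\<bar> \<le> (\<integral>y. \<bar>h1 y\<bar> \<partial>Nst l x)"
    by simp
  also have "\<dots> \<le> a * t"
    using int_N h1 by (intro N.integral_le_const AE_I2) (auto simp: space_Nst[OF x])
  finally have 1: "\<bar>\<integral>y. h1 y \<partial>Nst l x\<bar> \<le> a * t" .
  have "\<bar>\<integral>y. h1 y * q y \<partial>\<mu>\<bar> \<le> (\<integral>y. \<bar>h1 y * q y\<bar> \<partial>\<mu>)"
    by simp
  also have "\<dots> \<le> (\<integral>y. a * t * q y \<partial>\<mu>)"
  proof (rule integral_mono)
    show "integrable \<mu> (\<lambda>y. \<bar>h1 y * q y\<bar>)"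
      using int_q(1) by (rule integrable_abs)
  qed (use integrable_q h1 q_nonneg in \<open>auto simp: abs_mult intro!: mult_right_mono\<close>)
  also have "\<dots> = a * t"
    by (simp add: integral_q)
  finally have 2: "\<bar>\<integral>y. h1 y * q y \<partial>\<mu>\<bar> \<le> a * t" .
  have 3: "\<bar>(\<integral>y. h2 y \<partial>Nst l x) - (\<integral>y. h2 y * q y \<partial>\<mu>)\<bar> \<le> a / t * \<bar>R\<bar> * V x * \<tau> ^ l"
    using a \<open>0 < t\<close> by (intro geometric[OF x] h2) auto
  have "a / t * \<bar>R\<bar> * V x * \<tau> ^ l = a / t * \<bar>R\<bar> * t\<^sup>2"
    by (simp add: t2)
  also have "\<dots> = \<bar>R\<bar> * (a * t)"
    using \<open>0 < t\<close> by (simp add: power2_eq_square)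
  finally have 4: "a / t * \<bar>R\<bar> * V x * \<tau> ^ l = \<bar>R\<bar> * (a * t)" .
  have "(\<integral>y. h y \<partial>Nst l x) - (\<integral>y. h y * q y \<partial>\<mu>) =
      (\<integral>y. h1 y \<partial>Nst l x) - (\<integral>y. h1 y * q y \<partial>\<mu>) + ((\<integral>y. h2 y \<partial>Nst l x) - (\<integral>y. h2 y * q y \<partial>\<mu>))"
    using int_N int_q by (simp add: split distrib_right)
  then have "\<bar>(\<integral>y. h y \<partial>Nst l x) - (\<integral>y. h y * q y \<partial>\<mu>)\<bar> \<le> 2 * (a * t) + \<bar>R\<bar> * (a * t)"
    using 1 2 3 unfolding 4 by linarith
  also have "\<dots> = (2 + \<bar>R\<bar>) * (a * sqrt (V x)) * sqrt \<tau> ^ l"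
    by (simp add: t_def real_sqrt_mult real_sqrt_power algebra_simps)
  finally show ?thesis .
qed

end

section \<open>Second moments of additive functionals\<close>

lemma (in density_chain) nn_integral_Law_initial:
  assumes g: "\<And>n. i \<le> n \<Longrightarrow> g \<in> borel_measurable (Path n)"
    and upd: "\<And>xs j y. i < j \<Longrightarrow> g (xs(j := y)) = g xs" and "i \<le> n"
  shows "(\<integral>\<^sup>+xs. g xs \<partial>Law n) = (\<integral>\<^sup>+xs. g xs \<partial>Law i)"
  using \<open>i \<le> n\<close>
proof (induction n rule: dec_induct)
  case (step n)
  have "(\<integral>\<^sup>+xs. g xs \<partial>Law (Suc n)) = (\<integral>\<^sup>+xs. g xs \<partial>Law n)"
    using step(1) by (intro nn_integral_Law_Suc_initial g upd) auto
  then show ?case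
    unfolding step(3) .
qed (rule refl)

context ergodic_chain
begin

text \<open>Bounds on second moments in units of \<open>a\<^sup>2\<close>. \<open>incr_const\<close>
  comes from \<open>(u - v)\<^sup>2 \<le> 2 * u\<^sup>2 + 2 * v\<^sup>2\<close> for an increment and
  its stationary mean. \<open>cov_const\<close> is the constant of \<open>geometric_sqrt\<close>
  times half the sum of the bounds for a squared increment and for \<open>V\<close>.
  \<open>square_const\<close> adds to the diagonal term twice a geometric series of ratio
  \<open>sqrt \<tau>\<close>. They are fixed before any increments are, so they are the same for all
  alternatives.\<close>

definition "incr_const = 2 * (mean_V + stat_V\<^sup>2)"

definition "cov_const = (2 + \<bar>R\<bar>) * ((incr_const + mean_V) / 2)"

definition "square_const = incr_const + 2 * cov_const / (1 - sqrt \<tau>)"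

end

text \<open>An abstract additive functional of the chain: \<open>z\<close> will be the one-step
  log-likelihood ratio and \<open>a\<close> its amplitude.\<close>

locale increment_chain = ergodic_chain +
  fixes z :: "'a \<Rightarrow> 'a \<Rightarrow> real" and a :: real
  assumes z_measurable: "(\<lambda>(y, x). z y x) \<in> borel_measurable (\<mu> \<Otimes>\<^sub>M \<mu>)"
    and a_nonneg: "0 \<le> a"
    and z_square: "\<And>x. x \<in> space \<mu> \<Longrightarrow> (\<integral>\<^sup>+y. ennreal ((z y x)\<^sup>2) \<partial>Ker x) \<le> ennreal (a\<^sup>2 * V x)"
begin

definition "drift x = (\<integral>y. z y x \<partial>Ker x)"
definition "stat_drift = (\<integral>x. drift x * q x \<partial>\<mu>)"
text \<open>Subtracting the stationary mean does not make the increments uncorrelated, but it makes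
  their conditional means given a distant past decay. At \<open>i = 0\<close> truncated subtraction
  would read \<open>xs 0\<close> twice, so the moment bounds require
  \<open>1 \<le> i\<close>.\<close>

definition "incr (i :: nat) xs = z (xs i) (xs (i - 1)) - stat_drift"

section \<open>Conditional moments of a single increment\<close>

lemma z_measurable'[measurable (raw)]:
  assumes "f \<in> measurable N \<mu>" "g \<in> measurable N \<mu>"
  shows "(\<lambda>w. z (f w) (g w)) \<in> borel_measurable N"
  using measurable_compose[OF measurable_Pair[OF assms] z_measurable] by simp

lemma integrable_z_square:
  assumes x: "x \<in> space \<mu>"
  shows "integrable (Ker x) (\<lambda>y. (z y x)\<^sup>2)" and "(\<integral>y. (z y x)\<^sup>2 \<partial>Ker x) \<le> a\<^sup>2 * V x"
proof -
  have [measurable]: "(\<lambda>y. z y x) \<in> borel_measurable (Ker x)"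
    using x by (simp add: measurable_cong_sets[OF sets_Ker refl])
  show int: "integrable (Ker x) (\<lambda>y. (z y x)\<^sup>2)"
    using z_square[OF x] by (intro integrableI_nonneg) (auto intro: order.strict_trans1)
  show "(\<integral>y. (z y x)\<^sup>2 \<partial>Ker x) \<le> a\<^sup>2 * V x"
    using z_square[OF x] V_nonneg[OF x] by (simp add: nn_integral_eq_integral[OF int])
qed

lemma integrable_z:
  assumes x: "x \<in> space \<mu>" shows "integrable (Ker x) (\<lambda>y. z y x)"
proof -
  interpret K: prob_space "Ker x"
    by (rule prob_space_Ker[OF x])
  show ?thesis
    using x by (intro K.square_integrable_imp_integrable[OF _ integrable_z_square(1)[OF x]])
      (simp add: measurable_cong_sets[OF sets_Ker refl])
qed

text \<open>Jensen's inequality, read off from nonnegativity of the variance under the kernel.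
  \<open>g\<close> is general because both \<open>z\<close> and its absolute value are
  needed.\<close>

lemma abs_integral_le_sqrt:
  assumes x: "x \<in> space \<mu>" and g[measurable]: "g \<in> borel_measurable \<mu>"
    and int: "integrable (Ker x) (\<lambda>y. (g y)\<^sup>2)" and le: "(\<integral>y. (g y)\<^sup>2 \<partial>Ker x) \<le> a\<^sup>2 * V x"
  shows "\<bar>\<integral>y. g y \<partial>Ker x\<bar> \<le> a * sqrt (V x)"
proof -
  interpret K: prob_space "Ker x"
    by (rule prob_space_Ker[OF x])
  have "integrable (Ker x) g"
    using int by (rule K.square_integrable_imp_integrable[rotated]) (simp_all add: measurable_cong_sets[OF sets_Ker refl])
  then have "(\<integral>y. g y \<partial>Ker x)\<^sup>2 \<le> (\<integral>y. (g y)\<^sup>2 \<partial>Ker x)"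
    using K.variance_positive[of g] K.variance_eq[of g] int by simp
  also have "\<dots> \<le> (a * sqrt (V x))\<^sup>2"
    using le V_nonneg[OF x] by (simp add: power_mult_distrib)
  finally have "\<bar>\<integral>y. g y \<partial>Ker x\<bar> \<le> \<bar>a * sqrt (V x)\<bar>"
    unfolding abs_le_square_iff .
  then show ?thesis
    using a_nonneg V_nonneg[OF x] by simp
qed

lemma abs_drift_le: "x \<in> space \<mu> \<Longrightarrow> \<bar>drift x\<bar> \<le> a * sqrt (V x)"
  unfolding drift_def by (rule abs_integral_le_sqrt) (auto intro: integrable_z_square)

lemma sqrt_V_le: "x \<in> space \<mu> \<Longrightarrow> sqrt (V x) \<le> V x"
  using V_ge_1[of x] mult_left_mono[of 1 "sqrt (V x)" "sqrt (V x)"] by simp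

lemma drift_measurable[measurable]: "drift \<in> borel_measurable \<mu>"
proof -
  have eq: "drift x = enn2real (\<integral>\<^sup>+y. ennreal (z y x) \<partial>Ker x) - enn2real (\<integral>\<^sup>+y. ennreal (- z y x) \<partial>Ker x)"
    if "x \<in> space \<mu>" for x
    unfolding drift_def by (rule real_lebesgue_integral_def[OF integrable_z[OF that]])
  have [measurable]: "(\<lambda>x. \<integral>\<^sup>+y. ennreal (z y x) \<partial>Ker x) \<in> borel_measurable \<mu>"
    "(\<lambda>x. \<integral>\<^sup>+y. ennreal (- z y x) \<partial>Ker x) \<in> borel_measurable \<mu>"
    by (intro nn_integral_measurable_subprob_algebra2[where N=\<mu>] Ker_measurable; measurable)+
  show ?thesis
    by (subst measurable_cong[OF eq]) auto
qed

lemma abs_drift_le': "x \<in> space \<mu> \<Longrightarrow> \<bar>drift x\<bar> \<le> a * V x"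
  using abs_drift_le[of x] mult_left_mono[OF sqrt_V_le a_nonneg, of x] by linarith

lemma abs_stat_drift_le: "\<bar>stat_drift\<bar> \<le> a * stat_V"
proof -
  have int: "integrable \<mu> (\<lambda>x. drift x * q x)"
    by (rule integrable_stat[OF drift_measurable abs_drift_le'])
  have "\<bar>stat_drift\<bar> \<le> (\<integral>x. \<bar>drift x * q x\<bar> \<partial>\<mu>)"
    unfolding stat_drift_def by simp
  also have "\<dots> \<le> (\<integral>x. a * (V x * q x) \<partial>\<mu>)"
  proof (rule integral_mono)
    show "integrable \<mu> (\<lambda>x. \<bar>drift x * q x\<bar>)"
      using int by (rule integrable_abs)
    show "\<bar>drift x * q x\<bar> \<le> a * (V x * q x)" if "x \<in> space \<mu>" for x
      using mult_right_mono[OF abs_drift_le'[OF that] q_nonneg[OF that]] q_nonneg[OF that]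
      by (simp add: abs_mult mult.assoc)
  qed (use integrable_V_q in simp)
  also have "\<dots> = a * stat_V"
    by (simp add: stat_V_def)
  finally show ?thesis .
qed

lemma nn_integral_abs_z:
  assumes "i < n"
  shows "(\<integral>\<^sup>+xs. ennreal \<bar>z (xs (Suc i)) (xs i)\<bar> \<partial>Law n) \<le> ennreal (a * mean_V)"
proof -
  have meas: "(\<lambda>xs. ennreal \<bar>z (xs (Suc i)) (xs i)\<bar>) \<in> borel_measurable (Path n)" if "Suc i \<le> n" for n
  proof -
    have [measurable]: "(\<lambda>xs. xs (Suc i)) \<in> measurable (Path n) \<mu>" "(\<lambda>xs. xs i) \<in> measurable (Path n) \<mu>"
      using that by (auto intro: coord_measurable)
    show ?thesis
      by measurable
  qed
  have "(\<integral>\<^sup>+xs. ennreal \<bar>z (xs (Suc i)) (xs i)\<bar> \<partial>Law n) = (\<integral>\<^sup>+xs. ennreal \<bar>z (xs (Suc i)) (xs i)\<bar> \<partial>Law (Suc i))"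
    using assms meas by (intro nn_integral_Law_initial) auto
  also have "\<dots> = (\<integral>\<^sup>+xs. \<integral>\<^sup>+y. ennreal \<bar>z y (xs i)\<bar> \<partial>Ker (xs i) \<partial>Law i)"
    using meas[of "Suc i"] by (subst nn_integral_Law_Suc) simp_all
  also have "\<dots> \<le> (\<integral>\<^sup>+xs. ennreal (a * V (xs i)) \<partial>Law i)"
  proof (rule nn_integral_mono)
    fix xs assume "xs \<in> space (Law i)"
    then have x: "xs i \<in> space \<mu>"
      by (simp add: coord_space)
    have "(\<integral>\<^sup>+y. ennreal \<bar>z y (xs i)\<bar> \<partial>Ker (xs i)) = ennreal (\<integral>y. \<bar>z y (xs i)\<bar> \<partial>Ker (xs i))"
      by (intro nn_integral_eq_integral integrable_abs integrable_z x) simp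
    also have "(\<integral>y. \<bar>z y (xs i)\<bar> \<partial>Ker (xs i)) \<le> a * sqrt (V (xs i))"
      using abs_integral_le_sqrt[OF x, of "\<lambda>y. \<bar>z y (xs i)\<bar>"] integrable_z_square[OF x] x by simp
    also have "\<dots> \<le> a * V (xs i)"
      using mult_left_mono[OF sqrt_V_le[OF x] a_nonneg] .
    finally show "(\<integral>\<^sup>+y. ennreal \<bar>z y (xs i)\<bar> \<partial>Ker (xs i)) \<le> ennreal (a * V (xs i))"
      by (simp add: ennreal_leI)
  qed
  also have "\<dots> = ennreal a * (\<integral>\<^sup>+xs. ennreal (V (xs i)) \<partial>Law i)"
    using a_nonneg measurable_compose[OF coord_measurable[of i i] V_measurable]
    by (subst nn_integral_cmult[symmetric])
      (auto simp: ennreal_mult coord_space V_nonneg intro!: nn_integral_cong)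
  also have "\<dots> \<le> ennreal a * ennreal mean_V"
    by (intro mult_left_mono nn_integral_V) simp
  also have "\<dots> = ennreal (a * mean_V)"
    using a_nonneg mean_V_ge_1 by (simp add: ennreal_mult)
  finally show ?thesis .
qed

section \<open>Centred increments and their covariances\<close>

lemma incr_measurable:
  assumes "i \<le> n" shows "incr i \<in> borel_measurable (Path n)"
proof -
  have [measurable]: "(\<lambda>xs. xs i) \<in> measurable (Path n) \<mu>" "(\<lambda>xs. xs (i - 1)) \<in> measurable (Path n) \<mu>"
    using assms by (auto intro: coord_measurable)
  show ?thesis
    unfolding incr_def by measurable
qed

lemma incr_upd: "i < j \<Longrightarrow> incr i (xs(j := y)) = incr i xs"
  by (auto simp: incr_def)

lemma nn_integral_incr_square:
  assumes "1 \<le> i" "i \<le> n"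
  shows "(\<integral>\<^sup>+xs. ennreal ((incr i xs)\<^sup>2) \<partial>Law n) \<le> ennreal (a\<^sup>2 * incr_const)"
proof -
  obtain k where i: "i = Suc k"
    using assms by (cases i) auto
  have meas: "(\<lambda>xs. ennreal ((incr i xs)\<^sup>2)) \<in> borel_measurable (Path n)" if "i \<le> n" for n
    using incr_measurable[OF that] by measurable
  have "(\<integral>\<^sup>+xs. ennreal ((incr i xs)\<^sup>2) \<partial>Law n) = (\<integral>\<^sup>+xs. ennreal ((incr i xs)\<^sup>2) \<partial>Law i)"
    using meas assms by (intro nn_integral_Law_initial) (auto simp: incr_upd)
  also have "\<dots> = (\<integral>\<^sup>+xs. \<integral>\<^sup>+y. ennreal ((z y (xs k) - stat_drift)\<^sup>2) \<partial>Ker (xs k) \<partial>Law k)"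
    using meas[of i] unfolding i by (subst nn_integral_Law_Suc) (auto simp: incr_def)
  also have "\<dots> \<le> (\<integral>\<^sup>+xs. ennreal (2 * a\<^sup>2) * (ennreal (V (xs k)) + ennreal (stat_V\<^sup>2)) \<partial>Law k)"
  proof (rule nn_integral_mono)
    fix xs assume "xs \<in> space (Law k)"
    then have x: "xs k \<in> space \<mu>"
      by (simp add: coord_space)
    interpret K: prob_space "Ker (xs k)"
      by (rule prob_space_Ker[OF x])
    have sq: "(u - v)\<^sup>2 \<le> 2 * u\<^sup>2 + 2 * v\<^sup>2" for u v :: real
      using zero_le_power2[of "u + v"] by (simp add: power2_eq_square algebra_simps)
    have "stat_drift\<^sup>2 \<le> (a * stat_V)\<^sup>2"
      using abs_stat_drift_le by (metis abs_ge_zero power2_abs power_mono)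
    have "(\<integral>\<^sup>+y. ennreal ((z y (xs k) - stat_drift)\<^sup>2) \<partial>Ker (xs k))
        \<le> (\<integral>\<^sup>+y. ennreal (2 * (z y (xs k))\<^sup>2 + 2 * stat_drift\<^sup>2) \<partial>Ker (xs k))"
      by (intro nn_integral_mono ennreal_leI sq)
    also have "\<dots> = ennreal (\<integral>y. 2 * (z y (xs k))\<^sup>2 + 2 * stat_drift\<^sup>2 \<partial>Ker (xs k))"
      using integrable_z_square(1)[OF x] by (intro nn_integral_eq_integral) auto
    also have "(\<integral>y. 2 * (z y (xs k))\<^sup>2 + 2 * stat_drift\<^sup>2 \<partial>Ker (xs k)) = 2 * (\<integral>y. (z y (xs k))\<^sup>2 \<partial>Ker (xs k)) + 2 * stat_drift\<^sup>2"
      using integrable_z_square(1)[OF x] K.prob_space by simp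
    also have "\<dots> \<le> 2 * (a\<^sup>2 * V (xs k)) + 2 * (a * stat_V)\<^sup>2"
      using integrable_z_square(2)[OF x] \<open>stat_drift\<^sup>2 \<le> (a * stat_V)\<^sup>2\<close> by linarith
    also have "\<dots> = 2 * a\<^sup>2 * (V (xs k) + stat_V\<^sup>2)"
      by (simp add: power_mult_distrib algebra_simps)
    finally show "(\<integral>\<^sup>+y. ennreal ((z y (xs k) - stat_drift)\<^sup>2) \<partial>Ker (xs k))
        \<le> ennreal (2 * a\<^sup>2) * (ennreal (V (xs k)) + ennreal (stat_V\<^sup>2))"
      using V_nonneg[OF x] by (simp add: ennreal_leI flip: ennreal_mult ennreal_plus)
  qed
  also have "\<dots> = ennreal (2 * a\<^sup>2) * ((\<integral>\<^sup>+xs. ennreal (V (xs k)) \<partial>Law k) + ennreal (stat_V\<^sup>2))"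
    using measurable_compose[OF coord_measurable[of k k] V_measurable] prob_space.emeasure_space_1[OF prob_space_Law, of k]
    by (simp add: nn_integral_cmult nn_integral_add)
  also have "\<dots> \<le> ennreal (2 * a\<^sup>2) * (ennreal mean_V + ennreal (stat_V\<^sup>2))"
    by (intro mult_left_mono add_right_mono nn_integral_V) simp
  also have "\<dots> = ennreal (a\<^sup>2 * incr_const)"
    using mean_V_ge_1 by (simp add: incr_const_def algebra_simps flip: ennreal_mult ennreal_plus)
  finally show ?thesis .
qed

lemma integrable_incr_square:
  assumes "1 \<le> i" "i \<le> n"
  shows "integrable (Law n) (\<lambda>xs. (incr i xs)\<^sup>2)" and "(\<integral>xs. (incr i xs)\<^sup>2 \<partial>Law n) \<le> a\<^sup>2 * incr_const"
proof -
  have [measurable]: "incr i \<in> borel_measurable (Law n)"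
    using incr_measurable[OF assms(2)] by (simp add: measurable_cong_sets[OF sets_Law refl])
  show int: "integrable (Law n) (\<lambda>xs. (incr i xs)\<^sup>2)"
    using nn_integral_incr_square[OF assms] by (intro integrableI_nonneg) (auto intro: order.strict_trans1)
  have "0 \<le> a\<^sup>2 * incr_const"
    using mean_V_ge_1 by (simp add: incr_const_def)
  then show "(\<integral>xs. (incr i xs)\<^sup>2 \<partial>Law n) \<le> a\<^sup>2 * incr_const"
    using nn_integral_incr_square[OF assms] by (simp add: nn_integral_eq_integral[OF int])
qed

lemma integrable_incr_mult:
  assumes "1 \<le> i" "i \<le> n" "1 \<le> j" "j \<le> n"
  shows "integrable (Law n) (\<lambda>xs. incr i xs * incr j xs)"
  using assms incr_measurable
  by (intro integrable_mult_of_squares integrable_incr_square) (simp_all add: measurable_cong_sets[OF sets_Law refl])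

lemma integrable_V_coord: "integrable (Law n) (\<lambda>xs. V (xs n))"
  and integral_V_coord: "(\<integral>xs. V (xs n) \<partial>Law n) \<le> mean_V"
proof -
  have meas: "(\<lambda>xs. V (xs n)) \<in> borel_measurable (Law n)"
    using measurable_compose[OF coord_measurable[of n n] V_measurable]
    by (simp add: measurable_cong_sets[OF sets_Law refl])
  have nonneg: "AE xs in Law n. 0 \<le> V (xs n)"
    by (intro AE_I2) (simp add: coord_space V_nonneg)
  show int: "integrable (Law n) (\<lambda>xs. V (xs n))"
    using nn_integral_V[of n] meas nonneg by (intro integrableI_nonneg) (auto intro: order.strict_trans1)
  show "(\<integral>xs. V (xs n) \<partial>Law n) \<le> mean_V"
    using nn_integral_V[of n] mean_V_ge_1 nonneg by (simp add: nn_integral_eq_integral[OF int])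
qed

text \<open>Given the path up to time \<open>n\<close>, the last increment has mean
  \<open>G (xs n)\<close>, and the Markov property carries \<open>G\<close> back to time
  \<open>i\<close>. The exponent is \<open>n - i\<close> and not \<open>Suc n - i\<close> because
  the drift is evaluated at the starting point of the increment.\<close>

lemma integral_incr_mult_bound:
  assumes "1 \<le> i" "i \<le> n"
  shows "\<bar>\<integral>xs. incr i xs * incr (Suc n) xs \<partial>Law (Suc n)\<bar> \<le> a\<^sup>2 * cov_const * sqrt \<tau> ^ (n - i)"
proof -
  define l where "l = n - i"
  have n: "n = i + l"
    using assms by (simp add: l_def)
  define G where "G x = drift x - stat_drift" for x
  have G_meas: "G \<in> borel_measurable \<mu>"
    unfolding G_def by measurable
  \<comment> \<open>This coarse bound by a multiple of \<open>V\<close> only secures integrability;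
    the decay in \<open>G_Nst\<close> rests on the sharper bound of the drift by
    \<open>a * sqrt (V x)\<close>.\<close>
  have G_bound: "\<bar>G x\<bar> \<le> (a + \<bar>stat_drift\<bar>) * V x" if "x \<in> space \<mu>" for x
    using abs_drift_le'[OF that] mult_left_mono[OF V_ge_1[OF that], of "\<bar>stat_drift\<bar>"]
    by (simp add: G_def distrib_right)
  have G_int: "integrable (Nst k x) G" if "x \<in> space \<mu>" for x k
    by (rule integrable_Nst[OF that G_meas G_bound])
  have int_Suc: "integrable (Law (Suc n)) (\<lambda>xs. incr i xs * incr (Suc n) xs)"
    using assms by (intro integrable_incr_mult) auto
  have inner: "(\<integral>y. incr i (xs(Suc n := y)) * incr (Suc n) (xs(Suc n := y)) \<partial>Ker (xs n)) = incr i xs * G (xs n)"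
    if xs: "xs \<in> space (Law n)" for xs
  proof -
    have x: "xs n \<in> space \<mu>"
      using xs by (simp add: coord_space)
    interpret K: prob_space "Ker (xs n)"
      by (rule prob_space_Ker[OF x])
    have "(\<integral>y. z y (xs n) - stat_drift \<partial>Ker (xs n)) = G (xs n)"
      using integrable_z[OF x] K.prob_space by (simp add: G_def drift_def)
    then show ?thesis
      using assms by (simp add: incr_upd) (simp add: incr_def)
  qed
  have int_n: "integrable (Law n) (\<lambda>xs. incr i xs * G (xs n))"
  proof (rule iffD1[OF Bochner_Integration.integrable_cong[OF refl]])
    show "integrable (Law n) (\<lambda>xs. \<integral>y. incr i (xs(Suc n := y)) * incr (Suc n) (xs(Suc n := y)) \<partial>Ker (xs n))"
      by (rule integral_Law_Suc(1)[OF int_Suc])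
  qed (rule inner)
  have eq_n: "(\<integral>xs. incr i xs * incr (Suc n) xs \<partial>Law (Suc n)) = (\<integral>xs. incr i xs * G (xs n) \<partial>Law n)"
    unfolding integral_Law_Suc(2)[OF int_Suc] by (intro Bochner_Integration.integral_cong refl inner)
  have markov: "integrable (Law i) (\<lambda>xs. incr i xs * (\<integral>y. G y \<partial>Nst l (xs i)))"
    "(\<integral>xs. incr i xs * G (xs n) \<partial>Law n) = (\<integral>xs. incr i xs * (\<integral>y. G y \<partial>Nst l (xs i)) \<partial>Law i)"
    using integral_Law_markov[where G=G and W="incr i" and i=i and l=l, OF G_meas G_int incr_upd int_n[unfolded n]]
    unfolding n by auto
  have G_Nst: "\<bar>\<integral>y. G y \<partial>Nst l x\<bar> \<le> (2 + \<bar>R\<bar>) * (a * sqrt (V x)) * sqrt \<tau> ^ l" if x: "x \<in> space \<mu>" for x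
  proof -
    interpret N: prob_space "Nst l x"
      by (rule prob_space_Nst[OF x])
    have "(\<integral>y. G y \<partial>Nst l x) = (\<integral>y. drift y \<partial>Nst l x) - (\<integral>y. drift y * q y \<partial>\<mu>)"
      using integrable_Nst[OF x drift_measurable abs_drift_le'] N.prob_space
      by (simp add: G_def[abs_def] stat_drift_def)
    then show ?thesis
      using geometric_sqrt[OF x drift_measurable abs_drift_le a_nonneg] by simp
  qed
  have "\<bar>\<integral>xs. incr i xs * (\<integral>y. G y \<partial>Nst l (xs i)) \<partial>Law i\<bar>
      \<le> (\<integral>xs. \<bar>incr i xs * (\<integral>y. G y \<partial>Nst l (xs i))\<bar> \<partial>Law i)"
    by simp
  also have "\<dots> \<le> (\<integral>xs. (2 + \<bar>R\<bar>) * sqrt \<tau> ^ l * (((incr i xs)\<^sup>2 + a\<^sup>2 * V (xs i)) / 2) \<partial>Law i)"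
  proof (rule integral_mono)
    show "integrable (Law i) (\<lambda>xs. \<bar>incr i xs * (\<integral>y. G y \<partial>Nst l (xs i))\<bar>)"
      using markov(1) by (rule integrable_abs)
    show "integrable (Law i) (\<lambda>xs. (2 + \<bar>R\<bar>) * sqrt \<tau> ^ l * (((incr i xs)\<^sup>2 + a\<^sup>2 * V (xs i)) / 2))"
      using integrable_incr_square(1)[OF assms(1) order_refl] integrable_V_coord by simp
    fix xs assume "xs \<in> space (Law i)"
    then have x: "xs i \<in> space \<mu>"
      by (simp add: coord_space)
    have "\<bar>incr i xs * (\<integral>y. G y \<partial>Nst l (xs i))\<bar> \<le> \<bar>incr i xs\<bar> * ((2 + \<bar>R\<bar>) * (a * sqrt (V (xs i))) * sqrt \<tau> ^ l)"
      unfolding abs_mult by (intro mult_left_mono G_Nst x) simp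
    also have "\<dots> = (2 + \<bar>R\<bar>) * sqrt \<tau> ^ l * \<bar>incr i xs * (a * sqrt (V (xs i)))\<bar>"
      using a_nonneg V_nonneg[OF x] by (simp add: abs_mult)
    \<comment> \<open>Keeping \<open>a\<close> next to \<open>sqrt V\<close> gives both squares a
      mean of order \<open>a\<^sup>2\<close>. Squaring turns \<open>sqrt V\<close> into
      \<open>V\<close>, whose mean is bounded in time.\<close>
    also have "\<dots> \<le> (2 + \<bar>R\<bar>) * sqrt \<tau> ^ l * (((incr i xs)\<^sup>2 + (a * sqrt (V (xs i)))\<^sup>2) / 2)"
      using tau by (intro mult_left_mono abs_mult_le_half_squares) auto
    also have "(a * sqrt (V (xs i)))\<^sup>2 = a\<^sup>2 * V (xs i)"
      using V_nonneg[OF x] by (simp add: power_mult_distrib)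
    finally show "\<bar>incr i xs * (\<integral>y. G y \<partial>Nst l (xs i))\<bar>
        \<le> (2 + \<bar>R\<bar>) * sqrt \<tau> ^ l * (((incr i xs)\<^sup>2 + a\<^sup>2 * V (xs i)) / 2)" .
  qed
  also have "\<dots> = (2 + \<bar>R\<bar>) * sqrt \<tau> ^ l * (((\<integral>xs. (incr i xs)\<^sup>2 \<partial>Law i) + a\<^sup>2 * (\<integral>xs. V (xs i) \<partial>Law i)) / 2)"
    using integrable_incr_square(1)[OF assms(1) order_refl] integrable_V_coord by simp
  also have "\<dots> \<le> (2 + \<bar>R\<bar>) * sqrt \<tau> ^ l * ((a\<^sup>2 * incr_const + a\<^sup>2 * mean_V) / 2)"
    using tau integrable_incr_square(2)[OF assms(1) order_refl] integral_V_coord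
    by (intro mult_left_mono divide_right_mono add_mono) auto
  also have "\<dots> = a\<^sup>2 * cov_const * sqrt \<tau> ^ l"
    by (simp add: cov_const_def algebra_simps add_divide_distrib)
  finally show ?thesis
    unfolding eq_n markov(2) l_def .
qed

text \<open>By induction: a new increment adds its own second moment and twice its covariances with
  all earlier ones. The latter are dominated by a geometric series in the time lag, so one step
  costs at most \<open>a\<^sup>2 * square_const\<close> whatever \<open>n\<close> is.\<close>

lemma sum_incr_square:
  "integrable (Law n) (\<lambda>xs. (\<Sum>i=1..n. incr i xs)\<^sup>2) \<and>
    (\<integral>xs. (\<Sum>i=1..n. incr i xs)\<^sup>2 \<partial>Law n) \<le> real n * (a\<^sup>2 * square_const)"
proof (induction n)
  case 0
  show ?case by simp
next
  case (Suc n)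
  define T where "T xs = (\<Sum>i=1..n. incr i xs)" for xs
  have expand: "(\<Sum>i=1..Suc n. incr i xs)\<^sup>2 =
      (T xs)\<^sup>2 + 2 * (\<Sum>i=1..n. incr i xs * incr (Suc n) xs) + (incr (Suc n) xs)\<^sup>2" for xs
    by (simp add: T_def power2_sum sum_distrib_right)
  have T_meas: "T \<in> borel_measurable (Path k)" if "n \<le> k" for k
    unfolding T_def using that by (intro borel_measurable_sum incr_measurable) auto
  have int_T: "integrable (Law (Suc n)) (\<lambda>xs. (T xs)\<^sup>2)"
    unfolding T_def power2_eq_square sum_product
    by (intro Bochner_Integration.integrable_sum integrable_incr_mult) auto
  have "(\<integral>\<^sup>+xs. ennreal ((T xs)\<^sup>2) \<partial>Law (Suc n)) = (\<integral>\<^sup>+xs. ennreal ((T xs)\<^sup>2) \<partial>Law n)"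
  proof (rule nn_integral_Law_Suc_initial)
    show "(\<lambda>xs. ennreal ((T xs)\<^sup>2)) \<in> borel_measurable (Path n)"
      "(\<lambda>xs. ennreal ((T xs)\<^sup>2)) \<in> borel_measurable (Path (Suc n))"
      using T_meas[of n] T_meas[of "Suc n"] by simp_all
    show "ennreal ((T (xs(Suc n := y)))\<^sup>2) = ennreal ((T xs)\<^sup>2)" for xs y
      unfolding T_def by (intro arg_cong[where f="\<lambda>t. ennreal (t\<^sup>2)"] sum.cong refl incr_upd) auto
  qed
  then have "(\<integral>xs. (T xs)\<^sup>2 \<partial>Law (Suc n)) = (\<integral>xs. (T xs)\<^sup>2 \<partial>Law n)"
    using Suc.IH int_T integral_eq_nn_integral[of "\<lambda>xs. (T xs)\<^sup>2"] unfolding T_def[symmetric]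
    by (metis (no_types, lifting) AE_I2 borel_measurable_integrable zero_le_power2)
  then have T_le: "(\<integral>xs. (T xs)\<^sup>2 \<partial>Law (Suc n)) \<le> real n * (a\<^sup>2 * square_const)"
    using Suc.IH by (simp add: T_def)
  have int_cross: "integrable (Law (Suc n)) (\<lambda>xs. incr i xs * incr (Suc n) xs)" if "i \<in> {1..n}" for i
    using that by (intro integrable_incr_mult) auto
  have int_last: "integrable (Law (Suc n)) (\<lambda>xs. (incr (Suc n) xs)\<^sup>2)"
    and last_le: "(\<integral>xs. (incr (Suc n) xs)\<^sup>2 \<partial>Law (Suc n)) \<le> a\<^sup>2 * incr_const"
    by (auto intro!: integrable_incr_square)
  have sqrt_tau: "0 \<le> sqrt \<tau>" "sqrt \<tau> < 1"
    using tau by auto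
  have cov_nonneg: "0 \<le> cov_const"
    using mean_V_ge_1 by (auto simp: cov_const_def incr_const_def intro!: mult_nonneg_nonneg add_nonneg_nonneg)
  have "(\<Sum>i=1..n. \<integral>xs. incr i xs * incr (Suc n) xs \<partial>Law (Suc n)) \<le> (\<Sum>i=1..n. a\<^sup>2 * cov_const * sqrt \<tau> ^ (n - i))"
    by (intro sum_mono order_trans[OF abs_ge_self integral_incr_mult_bound]) auto
  \<comment> \<open>Writing \<open>i = Suc k\<close> makes the lag \<open>n - Suc k\<close>;
    reversing the order of summation then leaves the powers from 0 to \<open>n - 1\<close>.\<close>
  also have "\<dots> = a\<^sup>2 * cov_const * (\<Sum>k<n. sqrt \<tau> ^ (n - Suc k))"
    by (simp add: sum_distrib_left sum.atLeast1_atMost_eq)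
  also have "(\<Sum>k<n. sqrt \<tau> ^ (n - Suc k)) = (\<Sum>k<n. sqrt \<tau> ^ k)"
    by (rule sum.nat_diff_reindex)
  also have "\<dots> = (1 - sqrt \<tau> ^ n) / (1 - sqrt \<tau>)"
    using sqrt_tau by (simp add: sum_gp_strict)
  also have "a\<^sup>2 * cov_const * ((1 - sqrt \<tau> ^ n) / (1 - sqrt \<tau>)) \<le> a\<^sup>2 * cov_const * (1 / (1 - sqrt \<tau>))"
    using sqrt_tau cov_nonneg by (intro mult_left_mono divide_right_mono) auto
  finally have cross_le: "(\<Sum>i=1..n. \<integral>xs. incr i xs * incr (Suc n) xs \<partial>Law (Suc n)) \<le> a\<^sup>2 * cov_const * (1 / (1 - sqrt \<tau>))" .
  have int_sum: "integrable (Law (Suc n)) (\<lambda>xs. \<Sum>i=1..n. incr i xs * incr (Suc n) xs)"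
    by (intro Bochner_Integration.integrable_sum int_cross)
  have "(\<integral>xs. (\<Sum>i=1..Suc n. incr i xs)\<^sup>2 \<partial>Law (Suc n)) =
      (\<integral>xs. (T xs)\<^sup>2 \<partial>Law (Suc n)) + 2 * (\<Sum>i=1..n. \<integral>xs. incr i xs * incr (Suc n) xs \<partial>Law (Suc n))
      + (\<integral>xs. (incr (Suc n) xs)\<^sup>2 \<partial>Law (Suc n))"
    unfolding expand using int_T int_sum int_last int_cross
    by (simp add: Bochner_Integration.integral_sum)
  also have "\<dots> \<le> real n * (a\<^sup>2 * square_const) + 2 * (a\<^sup>2 * cov_const * (1 / (1 - sqrt \<tau>))) + a\<^sup>2 * incr_const"
    using T_le cross_le last_le by linarith
  also have "\<dots> = real (Suc n) * (a\<^sup>2 * square_const)"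
    by (simp add: square_const_def algebra_simps add_divide_distrib)
  finally show ?case
    unfolding expand using int_T int_sum int_last by simp
qed

text \<open>The witness is \<open>real n * stat_drift\<close>. Its value can stay hidden, since any
  centre serves to bound a variance.\<close>

lemma nn_integral_sum_z_square:
  "\<exists>c. (\<integral>\<^sup>+xs. ennreal (((\<Sum>i=1..n. z (xs i) (xs (i - 1))) - c)\<^sup>2) \<partial>Law n) \<le> ennreal (real n * (a\<^sup>2 * square_const))"
proof
  have eq: "(\<Sum>i=1..n. incr i xs) = (\<Sum>i=1..n. z (xs i) (xs (i - 1))) - real n * stat_drift" for xs
    by (simp add: incr_def sum_subtractf)
  show "(\<integral>\<^sup>+xs. ennreal (((\<Sum>i=1..n. z (xs i) (xs (i - 1))) - real n * stat_drift)\<^sup>2) \<partial>Law n)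
      \<le> ennreal (real n * (a\<^sup>2 * square_const))"
    using sum_incr_square[of n] unfolding eq by (simp add: nn_integral_eq_integral ennreal_leI)
qed

lemma nn_integral_abs_sum_z:
  "(\<integral>\<^sup>+xs. ennreal \<bar>\<Sum>i=1..n. z (xs i) (xs (i - 1))\<bar> \<partial>Law n) \<le> ennreal (real n * (a * mean_V))"
proof -
  have meas: "(\<lambda>xs. ennreal \<bar>z (xs (Suc i)) (xs i)\<bar>) \<in> borel_measurable (Law n)" if "i \<in> {..<n}" for i
  proof -
    have [measurable]: "(\<lambda>xs. xs (Suc i)) \<in> measurable (Law n) \<mu>" "(\<lambda>xs. xs i) \<in> measurable (Law n) \<mu>"
      using that by (auto simp: measurable_cong_sets[OF sets_Law refl] intro: coord_measurable)
    show ?thesis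
      by measurable
  qed
  have "(\<integral>\<^sup>+xs. ennreal \<bar>\<Sum>i=1..n. z (xs i) (xs (i - 1))\<bar> \<partial>Law n)
      \<le> (\<integral>\<^sup>+xs. (\<Sum>i<n. ennreal \<bar>z (xs (Suc i)) (xs i)\<bar>) \<partial>Law n)"
    by (intro nn_integral_mono) (simp add: sum.atLeast1_atMost_eq sum_ennreal ennreal_leI sum_abs)
  also have "\<dots> = (\<Sum>i<n. \<integral>\<^sup>+xs. ennreal \<bar>z (xs (Suc i)) (xs i)\<bar> \<partial>Law n)"
    by (intro nn_integral_sum meas)
  also have "\<dots> \<le> (\<Sum>i<n. ennreal (a * mean_V))"
    by (intro sum_mono nn_integral_abs_z) simp
  also have "\<dots> = ennreal (real n * (a * mean_V))"
    using a_nonneg mean_V_ge_1 by (simp add: ennreal_mult ennreal_of_nat_eq_real_of_nat)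
  finally show ?thesis .
qed

end

section \<open>Log-likelihood ratios\<close>

text \<open>For \<open>Y = X - c\<close> the variance is the mean of the square minus the square of
  the mean. This lets the stationary centring replace the true mean of the log-likelihood
  ratio.\<close>

lemma Var_le_second_moment:
  assumes P: "prob_space P" and X: "integrable P X"
  shows "Var P X \<le> (\<integral>\<^sup>+x. ennreal ((X x - c)\<^sup>2) \<partial>P)"
proof (cases "(\<integral>\<^sup>+x. ennreal ((X x - c)\<^sup>2) \<partial>P) = \<infinity>")
  case False
  interpret prob_space P by (rule P)
  define Y where "Y x = X x - c" for x
  have int_Y: "integrable P Y"
    using X by (simp add: Y_def[abs_def])
  have int_Y2: "integrable P (\<lambda>x. (Y x)\<^sup>2)"
    using False X unfolding Y_def by (intro integrableI_nonneg) (auto simp: less_top)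
  have "expectation Y = expectation X - c"
    using X prob_space by (simp add: Y_def[abs_def])
  then have shift: "X x - expectation X = Y x - expectation Y" for x
    by (simp add: Y_def)
  have int_var: "integrable P (\<lambda>x. (Y x - expectation Y)\<^sup>2)"
    using int_Y int_Y2 by (simp add: power2_diff)
  have "variance Y \<le> expectation (\<lambda>x. (Y x)\<^sup>2)"
    using variance_eq[OF int_Y int_Y2] by simp
  then show ?thesis
    unfolding Var_def shift using X int_Y2 int_var
    by (simp add: nn_integral_eq_integral ennreal_leI flip: Y_def)
qed (simp add: top_greatest)

text \<open>Only the positive part of the log density is kept: \<open>ennreal\<close> truncates
  negative values to zero, and the integral subtracted in \<open>KL\<close> is nonnegative.\<close>

lemma KL_density_le:
  assumes "sigma_finite_measure Q" and [measurable]: "g \<in> borel_measurable Q"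
    and g: "\<And>x. x \<in> space Q \<Longrightarrow> 0 \<le> g x" and P: "P = density Q (\<lambda>x. ennreal (g x))"
  shows "KL P Q \<le> enn2ereal (\<integral>\<^sup>+x. ennreal (ln (g x)) \<partial>P)"
proof -
  interpret sigma_finite_measure Q by fact
  have ac: "absolutely_continuous Q P" "sets P = sets Q"
    unfolding P by (auto simp: absolutely_continuousI_density)
  have "AE x in Q. ennreal (g x) = RN_deriv Q P x"
    by (rule RN_deriv_unique) (auto simp: P)
  then have "AE x in P. ennreal (g x) = RN_deriv Q P x"
    by (rule absolutely_continuous_AE[OF ac(2) ac(1)])
  then have "AE x in P. ennreal (ln (enn2real (RN_deriv Q P x))) = ennreal (ln (g x))"
    using AE_space
  proof eventually_elim
    case (elim x)
    then have "0 \<le> g x"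
      using g by (simp add: P)
    then have "enn2real (RN_deriv Q P x) = g x"
      unfolding elim(1)[symmetric] by simp
    then show ?case
      by simp
  qed
  then have "(\<integral>\<^sup>+x. ennreal (ln (enn2real (RN_deriv Q P x))) \<partial>P) = (\<integral>\<^sup>+x. ennreal (ln (g x)) \<partial>P)"
    by (rule nn_integral_cong_AE)
  then show ?thesis
    using ac unfolding KL_def by (auto intro: ereal_diff_le_self)
qed

text \<open>Each \<open>\<bar>b i\<bar>\<close> is at most the Euclidean norm of \<open>b\<close>.
  The other factor is the square of a sum, so that its root is linear in the \<open>c i\<close> and
  the divergence can be bounded by first moments of the \<open>f k\<close>.\<close>

lemma sum_mult_square_le:
  fixes b c :: "'i \<Rightarrow> real"
  assumes "finite I" and c: "\<And>i. i \<in> I \<Longrightarrow> 0 \<le> c i"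
  shows "(\<Sum>i\<in>I. b i * c i)\<^sup>2 \<le> (\<Sum>i\<in>I. c i)\<^sup>2 * (\<Sum>i\<in>I. (b i)\<^sup>2)"
proof -
  define G where "G = sqrt (\<Sum>i\<in>I. (b i)\<^sup>2)"
  have b_le: "\<bar>b i\<bar> \<le> G" if "i \<in> I" for i
    unfolding G_def using that \<open>finite I\<close>
    by (intro real_le_rsqrt) (auto intro!: member_le_sum[where f="\<lambda>i. (b i)\<^sup>2"])
  have "\<bar>\<Sum>i\<in>I. b i * c i\<bar> \<le> (\<Sum>i\<in>I. \<bar>b i * c i\<bar>)"
    by (rule sum_abs)
  also have "\<dots> \<le> (\<Sum>i\<in>I. G * c i)"
    using b_le c by (intro sum_mono) (simp add: abs_mult mult_right_mono)
  also have "\<dots> = (\<Sum>i\<in>I. c i) * G"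
    by (simp add: sum_distrib_left mult.commute)
  finally have "(\<Sum>i\<in>I. b i * c i)\<^sup>2 \<le> ((\<Sum>i\<in>I. c i) * G)\<^sup>2"
    by (metis abs_ge_zero power2_abs power_mono)
  also have "\<dots> = (\<Sum>i\<in>I. c i)\<^sup>2 * (\<Sum>i\<in>I. (b i)\<^sup>2)"
    by (simp add: G_def power_mult_distrib sum_nonneg)
  finally show ?thesis .
qed

lemma sum_square_le_card:
  fixes c :: "'i \<Rightarrow> real"
  shows "(\<Sum>i\<in>I. c i)\<^sup>2 \<le> real (card I) * (\<Sum>i\<in>I. (c i)\<^sup>2)"
  using Cauchy_Schwarz_ineq_sum[of "\<lambda>_. 1" c I] by simp

lemma square_le_one_plus_powr:
  fixes t :: real
  assumes "0 \<le> t" "0 \<le> \<delta>"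
  shows "t\<^sup>2 \<le> 1 + t powr (2 + \<delta>)"
proof (cases "t \<le> 1")
  case True
  then have "t\<^sup>2 \<le> 1"
    using assms by (simp add: power_le_one)
  then show ?thesis
    by (simp add: add_increasing2)
next
  case False
  then have "t powr 2 \<le> t powr (2 + \<delta>)"
    using assms by (intro powr_mono) auto
  then show ?thesis
    using False by (simp add: powr_numeral)
qed

text \<open>The lower-order term is \<open>t\<close> and not 1, because it is integrated against
  \<open>\<rho> n\<close> and has to become of order \<open>1 / sqrt n\<close>. In
  \<open>square_le_one_plus_powr\<close>, meant for the \<open>M k\<close>, a constant is affordable
  since \<open>V\<close> is at least one.\<close>

lemma square_le_self_plus_powr:
  fixes t :: real
  assumes "0 \<le> t" "0 \<le> \<delta>"
  shows "t\<^sup>2 \<le> t + t powr (2 + \<delta>)"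
proof (cases "t \<le> 1")
  case True
  then have "t\<^sup>2 \<le> t"
    using assms by (simp add: power2_eq_square mult_left_le)
  then show ?thesis
    by (simp add: add_increasing2)
next
  case False
  then have "t powr 2 \<le> t powr (2 + \<delta>)"
    using assms by (intro powr_mono) auto
  then show ?thesis
    using False by (simp add: powr_numeral)
qed

lemma (in ergodic_chain) square_const_nonneg: "0 \<le> square_const"
  using mean_V_ge_1 tau
  by (auto simp: square_const_def cov_const_def incr_const_def intro!: add_nonneg_nonneg divide_nonneg_nonneg mult_nonneg_nonneg)

text \<open>\<open>\<theta>'\<close> is one fixed alternative, and \<open>\<phi> k\<close> will be
  \<open>\<bar>f k \<theta>' \<theta>\<bar>\<close>.\<close>

locale dominated_chain = ergodic_chain +
  fixes \<theta>' and M :: "nat \<Rightarrow> 'a \<Rightarrow> 'a \<Rightarrow> real" and \<phi> :: "nat \<Rightarrow> real" and m :: nat and \<delta> :: real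
  assumes alternative: "density_chain \<mu> q0 p \<theta>'"
    and M_measurable: "\<And>k. k \<in> {1..m} \<Longrightarrow> (\<lambda>(y, x). M k y x) \<in> borel_measurable (\<mu> \<Otimes>\<^sub>M \<mu>)"
    and M_nonneg: "\<And>k x y. k \<in> {1..m} \<Longrightarrow> x \<in> space \<mu> \<Longrightarrow> y \<in> space \<mu> \<Longrightarrow> 0 \<le> M k y x"
    and \<phi>_nonneg: "\<And>k. k \<in> {1..m} \<Longrightarrow> 0 \<le> \<phi> k"
    and same_support: "\<And>x y. x \<in> space \<mu> \<Longrightarrow> y \<in> space \<mu> \<Longrightarrow> p \<theta> y x = 0 \<longleftrightarrow> p \<theta>' y x = 0"
    and log_ratio: "\<And>x y. x \<in> space \<mu> \<Longrightarrow> y \<in> space \<mu> \<Longrightarrow> 0 < p \<theta> y x \<Longrightarrow>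
        \<bar>ln (p \<theta> y x) - ln (p \<theta>' y x)\<bar> \<le> (\<Sum>k=1..m. M k y x * \<phi> k)"
    and \<delta>_nonneg: "0 \<le> \<delta>"
    and M_moment: "\<And>k x. k \<in> {1..m} \<Longrightarrow> x \<in> space \<mu> \<Longrightarrow>
        (\<integral>\<^sup>+y. ennreal (M k y x powr (2 + \<delta>) * p \<theta> y x) \<partial>\<mu>) \<le> ennreal (V x)"
begin

interpretation alt: density_chain \<mu> q0 p \<theta>'
  by (rule alternative)

definition "llr y x = ln (p \<theta> y x) - ln (p \<theta>' y x)"
text \<open>Under the root, \<open>m\<close> arises from summing the bounds for the squares of the
  \<open>M k\<close>, and 2 is the factor in \<open>M_square\<close>.\<close>

definition "amp = (\<Sum>k=1..m. \<phi> k) * sqrt (2 * real m)"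

lemma llr_measurable: "(\<lambda>(y, x). llr y x) \<in> borel_measurable (\<mu> \<Otimes>\<^sub>M \<mu>)"
proof -
  have "(\<lambda>w. p \<theta> (fst w) (snd w)) \<in> borel_measurable (\<mu> \<Otimes>\<^sub>M \<mu>)"
    by (rule p_measurable'[OF measurable_fst measurable_snd])
  moreover have "(\<lambda>w. p \<theta>' (fst w) (snd w)) \<in> borel_measurable (\<mu> \<Otimes>\<^sub>M \<mu>)"
    by (rule alt.p_measurable'[OF measurable_fst measurable_snd])
  ultimately show ?thesis
    unfolding llr_def case_prod_beta' by (rule borel_measurable_diff[OF borel_measurable_ln borel_measurable_ln])
qed

lemma amp_nonneg: "0 \<le> amp"
  unfolding amp_def using \<phi>_nonneg by (intro mult_nonneg_nonneg sum_nonneg) auto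

lemma amp_square: "amp\<^sup>2 = (\<Sum>k=1..m. \<phi> k)\<^sup>2 * (2 * real m)"
  by (simp add: amp_def power_mult_distrib)

text \<open>The exponent \<open>2 + \<delta>\<close> is lowered to 2 at the price of an added 1,
  whose mean under the kernel is at most \<open>V x\<close>.\<close>

lemma M_square:
  assumes k: "k \<in> {1..m}" and x: "x \<in> space \<mu>"
  shows "(\<integral>\<^sup>+y. ennreal ((M k y x)\<^sup>2) \<partial>Ker x) \<le> ennreal (2 * V x)"
proof -
  have [measurable]: "(\<lambda>y. M k y x) \<in> borel_measurable \<mu>"
    using measurable_compose[OF measurable_Pair2'[OF x] M_measurable[OF k]] by simp
  have [measurable]: "(\<lambda>y. p \<theta> y x) \<in> borel_measurable \<mu>"
    by (rule p_measurable'[OF measurable_ident measurable_const[OF x], unfolded id_apply])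
  have "(\<integral>\<^sup>+y. ennreal ((M k y x)\<^sup>2) \<partial>Ker x) = (\<integral>\<^sup>+y. ennreal (p \<theta> y x) * ennreal ((M k y x)\<^sup>2) \<partial>\<mu>)"
    by (rule nn_integral_Ker[OF x]) simp
  also have "\<dots> \<le> (\<integral>\<^sup>+y. ennreal (p \<theta> y x) + ennreal (M k y x powr (2 + \<delta>) * p \<theta> y x) \<partial>\<mu>)"
  proof (rule nn_integral_mono)
    fix y assume y: "y \<in> space \<mu>"
    have "p \<theta> y x * (M k y x)\<^sup>2 \<le> p \<theta> y x * (1 + M k y x powr (2 + \<delta>))"
      by (intro mult_left_mono square_le_one_plus_powr M_nonneg k x y \<delta>_nonneg p_nonneg)
    then show "ennreal (p \<theta> y x) * ennreal ((M k y x)\<^sup>2)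
        \<le> ennreal (p \<theta> y x) + ennreal (M k y x powr (2 + \<delta>) * p \<theta> y x)"
      using p_nonneg[OF x y] by (simp add: ennreal_leI distrib_left mult.commute flip: ennreal_mult ennreal_plus)
  qed
  also have "\<dots> = (\<integral>\<^sup>+y. ennreal (p \<theta> y x) \<partial>\<mu>) + (\<integral>\<^sup>+y. ennreal (M k y x powr (2 + \<delta>) * p \<theta> y x) \<partial>\<mu>)"
    by (rule nn_integral_add) auto
  also have "\<dots> \<le> ennreal (V x) + ennreal (V x)"
    using p_integral[OF x] V_ge_1[OF x] M_moment[OF k x] by (intro add_mono) auto
  also have "\<dots> = ennreal (2 * V x)"
    using V_nonneg[OF x] by (simp flip: ennreal_plus)
  finally show ?thesis .
qed

lemma llr_square:
  assumes x: "x \<in> space \<mu>"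
  shows "(\<integral>\<^sup>+y. ennreal ((llr y x)\<^sup>2) \<partial>Ker x) \<le> ennreal (amp\<^sup>2 * V x)"
proof -
  have M_meas: "(\<lambda>y. ennreal ((M k y x)\<^sup>2)) \<in> borel_measurable (Ker x)" if "k \<in> {1..m}" for k
    using measurable_compose[OF measurable_Pair2'[OF x] M_measurable[OF that]]
    by (simp add: measurable_cong_sets[OF sets_Ker refl])
  have "(\<integral>\<^sup>+y. ennreal ((llr y x)\<^sup>2) \<partial>Ker x)
      \<le> (\<integral>\<^sup>+y. ennreal ((\<Sum>k=1..m. \<phi> k)\<^sup>2) * (\<Sum>k=1..m. ennreal ((M k y x)\<^sup>2)) \<partial>Ker x)"
  proof (rule nn_integral_mono)
    fix y assume "y \<in> space (Ker x)"
    then have y: "y \<in> space \<mu>"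
      by simp
    have "(llr y x)\<^sup>2 \<le> (\<Sum>k=1..m. \<phi> k)\<^sup>2 * (\<Sum>k=1..m. (M k y x)\<^sup>2)"
    proof (cases "p \<theta> y x = 0")
      \<comment> \<open>Both densities vanish here, so the two logarithms are the same value and
        \<open>llr\<close> is zero.\<close>
      case True
      then show ?thesis
        using same_support[OF x y] by (simp add: llr_def sum_nonneg)
    next
      case False
      then have "\<bar>llr y x\<bar> \<le> (\<Sum>k=1..m. M k y x * \<phi> k)"
        unfolding llr_def using p_nonneg[OF x y] by (intro log_ratio x y) simp
      then have "(llr y x)\<^sup>2 \<le> (\<Sum>k=1..m. M k y x * \<phi> k)\<^sup>2"
        by (metis abs_ge_zero power2_abs power_mono)
      also have "\<dots> \<le> (\<Sum>k=1..m. \<phi> k)\<^sup>2 * (\<Sum>k=1..m. (M k y x)\<^sup>2)"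
        using \<phi>_nonneg by (intro sum_mult_square_le) auto
      finally show ?thesis .
    qed
    then show "ennreal ((llr y x)\<^sup>2) \<le> ennreal ((\<Sum>k=1..m. \<phi> k)\<^sup>2) * (\<Sum>k=1..m. ennreal ((M k y x)\<^sup>2))"
      by (simp add: ennreal_leI sum_ennreal sum_nonneg flip: ennreal_mult)
  qed
  also have "\<dots> = ennreal ((\<Sum>k=1..m. \<phi> k)\<^sup>2) * (\<Sum>k=1..m. \<integral>\<^sup>+y. ennreal ((M k y x)\<^sup>2) \<partial>Ker x)"
    using M_meas by (simp only: nn_integral_cmult nn_integral_sum borel_measurable_sum)
  also have "\<dots> \<le> ennreal ((\<Sum>k=1..m. \<phi> k)\<^sup>2) * (\<Sum>k=1..m. ennreal (2 * V x))"
    by (intro mult_left_mono sum_mono M_square x) auto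
  also have "\<dots> = ennreal (amp\<^sup>2 * V x)"
    using V_nonneg[OF x] by (simp add: amp_square ennreal_of_nat_eq_real_of_nat mult_ac flip: ennreal_mult)
  finally show ?thesis .
qed

interpretation inc: increment_chain \<mu> q0 p \<theta> V q R \<tau> llr amp
  by unfold_locales (fact llr_measurable amp_nonneg llr_square)+

section \<open>Likelihood ratios of whole paths\<close>

lemma pathdens_eq_0_iff:
  assumes "xs \<in> space (Path n)"
  shows "pathdens q0 p \<theta>' n xs = 0 \<longleftrightarrow> pathdens q0 p \<theta> n xs = 0"
proof -
  have "p \<theta>' (xs i) (xs (i - 1)) = 0 \<longleftrightarrow> p \<theta> (xs i) (xs (i - 1)) = 0" if "i \<in> {1..n}" for i
    using that same_support[of "xs (i - 1)" "xs i"] coord_space[OF assms, of "i - 1"] coord_space[OF assms, of i]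
    by auto
  then show ?thesis
    unfolding pathdens_def by (simp add: prod_zero_iff)
qed

text \<open>The common initial density cancels and the logarithm of the product splits. This needs
  every factor to be positive, which for the alternative follows from equality of supports.\<close>

lemma rn_eq_sum_llr:
  assumes xs: "xs \<in> space (Path n)" and pos: "pathdens q0 p \<theta> n xs \<noteq> 0"
  shows "rn q0 p \<theta>' \<theta> n xs = (\<Sum>i=1..n. llr (xs i) (xs (i - 1)))"
proof -
  have pos': "0 < q0 (xs 0)" "\<And>i. i \<in> {1..n} \<Longrightarrow> 0 < p \<theta> (xs i) (xs (i - 1))"
    using pos q0_nonneg[OF coord_space[OF xs, of 0]] p_nonneg[OF coord_space[OF xs] coord_space[OF xs]]
    by (auto simp: pathdens_def less_le prod_zero_iff)
  have pos'': "0 < p \<theta>' (xs i) (xs (i - 1))" if "i \<in> {1..n}" for i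
  proof -
    have "xs (i - 1) \<in> space \<mu>" "xs i \<in> space \<mu>"
      using that coord_space[OF xs] by auto
    then show ?thesis
      using pos'(2)[OF that] same_support alt.p_nonneg by (metis less_le)
  qed
  define A where "A = (\<Prod>i=1..n. p \<theta> (xs i) (xs (i - 1)))"
  define B where "B = (\<Prod>i=1..n. p \<theta>' (xs i) (xs (i - 1)))"
  have "0 < A" "0 < B"
    unfolding A_def B_def using pos' pos'' by (auto intro!: prod_pos)
  have "rn q0 p \<theta>' \<theta> n xs = ln (q0 (xs 0) * A / (q0 (xs 0) * B))"
    by (simp add: rn_def pathdens_def A_def B_def)
  also have "\<dots> = ln A - ln B"
    using pos'(1) \<open>0 < A\<close> \<open>0 < B\<close> by (simp add: ln_div)
  also have "\<dots> = (\<Sum>i=1..n. ln (p \<theta> (xs i) (xs (i - 1)))) - (\<Sum>i=1..n. ln (p \<theta>' (xs i) (xs (i - 1))))"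
    unfolding A_def B_def using pos' pos'' by (intro arg_cong2[where f="(-)"] ln_prod) force+
  finally show ?thesis
    by (simp add: llr_def sum_subtractf)
qed

text \<open>The identity can fail only where the path density vanishes, and that set is null for the
  path law.\<close>

lemma AE_rn_eq: "AE xs in Law n. rn q0 p \<theta>' \<theta> n xs = (\<Sum>i=1..n. llr (xs i) (xs (i - 1)))"
proof -
  have "AE xs in Path n. 0 < ennreal (pathdens q0 p \<theta> n xs) \<longrightarrow>
      rn q0 p \<theta>' \<theta> n xs = (\<Sum>i=1..n. llr (xs i) (xs (i - 1)))"
    by (intro AE_I2 impI rn_eq_sum_llr) auto
  then show ?thesis
    unfolding pathlaw_def by (subst AE_density) auto
qed

lemma rn_measurable[measurable]: "rn q0 p \<theta>' \<theta> n \<in> borel_measurable (Path n)"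
  using pathdens_measurable alt.pathdens_measurable unfolding rn_def[abs_def] by measurable

lemma nn_integral_abs_rn: "(\<integral>\<^sup>+xs. ennreal \<bar>rn q0 p \<theta>' \<theta> n xs\<bar> \<partial>Law n) \<le> ennreal (real n * (amp * mean_V))"
proof -
  have "(\<integral>\<^sup>+xs. ennreal \<bar>rn q0 p \<theta>' \<theta> n xs\<bar> \<partial>Law n)
      = (\<integral>\<^sup>+xs. ennreal \<bar>\<Sum>i=1..n. llr (xs i) (xs (i - 1))\<bar> \<partial>Law n)"
    using AE_rn_eq[of n] by (intro nn_integral_cong_AE) (auto elim: eventually_mono)
  also have "\<dots> \<le> ennreal (real n * (amp * mean_V))"
    by (rule inc.nn_integral_abs_sum_z)
  finally show ?thesis .
qed

lemma Var_rn_le: "Var (Law n) (rn q0 p \<theta>' \<theta> n) \<le> ennreal (real n * (amp\<^sup>2 * square_const))"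
proof -
  obtain c where c: "(\<integral>\<^sup>+xs. ennreal (((\<Sum>i=1..n. llr (xs i) (xs (i - 1))) - c)\<^sup>2) \<partial>Law n)
      \<le> ennreal (real n * (amp\<^sup>2 * square_const))"
    using inc.nn_integral_sum_z_square by blast
  \<comment> \<open>\<open>Var\<close> is infinite by definition when integrability fails, so
    integrability has to come first.\<close>
  have "integrable (Law n) (rn q0 p \<theta>' \<theta> n)"
    using nn_integral_abs_rn[of n]
    by (intro integrableI_bounded) (auto simp: measurable_cong_sets[OF sets_Law refl] intro: order.strict_trans1)
  then have "Var (Law n) (rn q0 p \<theta>' \<theta> n) \<le> (\<integral>\<^sup>+xs. ennreal ((rn q0 p \<theta>' \<theta> n xs - c)\<^sup>2) \<partial>Law n)"
    by (rule Var_le_second_moment[OF prob_space_Law])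
  also have "\<dots> = (\<integral>\<^sup>+xs. ennreal (((\<Sum>i=1..n. llr (xs i) (xs (i - 1))) - c)\<^sup>2) \<partial>Law n)"
    using AE_rn_eq[of n] by (intro nn_integral_cong_AE) (auto elim: eventually_mono)
  also note c
  finally show ?thesis .
qed

lemma KL_le: "KL (Law n) (pathlaw \<mu> q0 p \<theta>' n) \<le> ereal (real n * (amp * mean_V))"
proof -
  let ?f = "pathdens q0 p \<theta> n" and ?f' = "pathdens q0 p \<theta>' n"
  note [measurable] = pathdens_measurable alt.pathdens_measurable
  have law: "Law n = density (pathlaw \<mu> q0 p \<theta>' n) (\<lambda>xs. ennreal (?f xs / ?f' xs))"
  proof -
    have "density (pathlaw \<mu> q0 p \<theta>' n) (\<lambda>xs. ennreal (?f xs / ?f' xs))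
        = density (Path n) (\<lambda>xs. ennreal (?f' xs) * ennreal (?f xs / ?f' xs))"
      unfolding pathlaw_def by (rule density_density_eq) measurable
    also have "\<dots> = Law n"
      unfolding pathlaw_def
    proof (rule density_cong)
      show "AE xs in Path n. ennreal (?f' xs) * ennreal (?f xs / ?f' xs) = ennreal (?f xs)"
      proof (rule AE_I2)
        fix xs assume xs: "xs \<in> space (Path n)"
        \<comment> \<open>Where \<open>?f'\<close> vanishes the quotient is 0 by convention; this is
          correct because \<open>?f\<close> vanishes there too.\<close>
        show "ennreal (?f' xs) * ennreal (?f xs / ?f' xs) = ennreal (?f xs)"
          using pathdens_eq_0_iff[OF xs] pathdens_nonneg[OF xs] alt.pathdens_nonneg[OF xs]
          by (cases "?f' xs = 0") (simp_all flip: ennreal_mult)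
      qed
    qed measurable
    finally show ?thesis ..
  qed
  have "KL (Law n) (pathlaw \<mu> q0 p \<theta>' n) \<le> enn2ereal (\<integral>\<^sup>+xs. ennreal (ln (?f xs / ?f' xs)) \<partial>Law n)"
  proof (rule KL_density_le)
    show "sigma_finite_measure (pathlaw \<mu> q0 p \<theta>' n)"
      using alt.prob_space_Law by (simp add: prob_space_def finite_measure_def)
    show "(\<lambda>xs. ?f xs / ?f' xs) \<in> borel_measurable (pathlaw \<mu> q0 p \<theta>' n)"
      unfolding measurable_cong_sets[OF alt.sets_Law refl] by measurable
    show "0 \<le> ?f xs / ?f' xs" if "xs \<in> space (pathlaw \<mu> q0 p \<theta>' n)" for xs
      using that pathdens_nonneg alt.pathdens_nonneg by simp
    show "Law n = density (pathlaw \<mu> q0 p \<theta>' n) (\<lambda>xs. ennreal (?f xs / ?f' xs))"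
      by (rule law)
  qed
  \<comment> \<open>The integrand on the left is the positive part of the log-likelihood ratio,
    which is at most its absolute value.\<close>
  also have "\<dots> \<le> enn2ereal (\<integral>\<^sup>+xs. ennreal \<bar>rn q0 p \<theta>' \<theta> n xs\<bar> \<partial>Law n)"
    unfolding less_eq_ennreal.rep_eq[symmetric] by (intro nn_integral_mono ennreal_leI) (simp add: rn_def)
  also have "\<dots> \<le> enn2ereal (ennreal (real n * (amp * mean_V)))"
    unfolding less_eq_ennreal.rep_eq[symmetric] by (rule nn_integral_abs_rn)
  also have "\<dots> = ereal (real n * (amp * mean_V))"
    using amp_nonneg mean_V_ge_1 by (simp add: enn2ereal_ennreal)
  finally show ?thesis .
qed

end

section \<open>The convergence rate\<close>

theorem mainTheorem10:
  fixes S :: "(real ^ 's) set" and \<mu> :: "(real ^ 's) measure"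
    and \<Theta> :: "(real ^ 'd) set" and \<theta>0 :: "real ^ 'd"
    and q0 :: "real ^ 's \<Rightarrow> real"
    and p :: "real ^ 'd \<Rightarrow> real ^ 's \<Rightarrow> real ^ 's \<Rightarrow> real"
    and V q :: "real ^ 's \<Rightarrow> real" and R \<tau> :: real
    and m :: nat and M :: "nat \<Rightarrow> real ^ 's \<Rightarrow> real ^ 's \<Rightarrow> real"
    and f :: "nat \<Rightarrow> real ^ 'd \<Rightarrow> real ^ 'd \<Rightarrow> real"
    and \<delta> C :: real
    and \<F> :: "(real ^ 'd) measure set" and \<pi> :: "(real ^ 'd) measure"
    and \<rho> :: "nat \<Rightarrow> (real ^ 'd) measure"
  assumes base: "\<mu> = restrict_space lborel S \<or> \<mu> = count_space S"
    and theta0: "\<theta>0 \<in> \<Theta>"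
    and q0_meas: "q0 \<in> borel_measurable \<mu>" and q0_nonneg: "\<forall>x\<in>S. 0 \<le> q0 x"
    and q0_int: "(\<integral>\<^sup>+x. ennreal (q0 x) \<partial>\<mu>) = 1"
    and p_meas: "(\<lambda>(\<theta>, y, x). p \<theta> y x) \<in> borel_measurable
                   (restrict_space borel \<Theta> \<Otimes>\<^sub>M \<mu> \<Otimes>\<^sub>M \<mu>)"
    and p_dens: "\<forall>\<theta>\<in>\<Theta>. \<forall>x\<in>S. (\<forall>y\<in>S. 0 \<le> p \<theta> y x) \<and> (\<integral>\<^sup>+y. ennreal (p \<theta> y x) \<partial>\<mu>) = 1"
    and aper: "aperiodic \<mu> p \<theta>0"
    and pharris: "positive_harris \<mu> p \<theta>0"
    and V_meas: "V \<in> borel_measurable \<mu>" and V_ge1: "\<forall>x\<in>S. 1 \<le> V x"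
    and q_meas: "q \<in> borel_measurable \<mu>" and q_nonneg: "\<forall>x\<in>S. 0 \<le> q x"
    and q_inv: "invariant_prob \<mu> p \<theta>0 (density \<mu> (\<lambda>x. ennreal (q x)))"
    and V_q: "(\<integral>\<^sup>+x. ennreal (V x * q x) \<partial>\<mu>) < \<infinity>"
    and tau: "0 < \<tau>" "\<tau> < 1"
    and geom: "V_geom_ergodic \<mu> p \<theta>0 V q R \<tau>"
    and M_meas: "\<forall>k\<in>{1..m}. (\<lambda>(y, x). M k y x) \<in> borel_measurable (\<mu> \<Otimes>\<^sub>M \<mu>)"
    and M_nonneg: "\<forall>k\<in>{1..m}. \<forall>x\<in>S. \<forall>y\<in>S. 0 \<le> M k y x"
    and lip: "\<forall>\<theta>1\<in>\<Theta>. \<forall>\<theta>2\<in>\<Theta>. \<forall>x\<in>S. \<forall>y\<in>S.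
               (p \<theta>1 y x = 0 \<longleftrightarrow> p \<theta>2 y x = 0) \<and>
               (0 < p \<theta>1 y x \<longrightarrow>
                 \<bar>ln (p \<theta>1 y x) - ln (p \<theta>2 y x)\<bar> \<le> (\<Sum>k=1..m. M k y x * \<bar>f k \<theta>2 \<theta>1\<bar>))"
    and delta: "0 < \<delta>"
    and M_mom: "\<forall>k\<in>{1..m}. \<forall>x\<in>S.
               (\<integral>\<^sup>+y. ennreal (M k y x powr (2 + \<delta>) * p \<theta>0 y x) \<partial>\<mu>) < ennreal (V x)"
    and f_meas: "\<forall>k\<in>{1..m}. (\<lambda>\<theta>. f k \<theta> \<theta>0) \<in> borel_measurable (restrict_space borel \<Theta>)"
    and F: "\<forall>\<nu>\<in>\<F>. prob_space \<nu> \<and> sets \<nu> = sets (restrict_space borel \<Theta>)"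
    and prior: "prob_space \<pi>" "sets \<pi> = sets (restrict_space borel \<Theta>)"
    and rho_F: "\<forall>n\<ge>1. \<rho> n \<in> \<F>"
    and C: "0 < C"
    and f_mom1: "\<forall>k\<in>{1..m}. \<forall>n\<ge>1.
               (\<integral>\<^sup>+\<theta>. ennreal (\<bar>f k \<theta> \<theta>0\<bar> powr (2 + \<delta>)) \<partial>\<rho> n) \<le> ennreal (C / real n)"
    and f_mom2: "\<forall>k\<in>{1..m}. \<forall>n\<ge>1.
               (\<integral>\<^sup>+\<theta>. ennreal \<bar>f k \<theta> \<theta>0\<bar> \<partial>\<rho> n) \<le> ennreal (C / sqrt (real n))"
    and KL_rho: "\<forall>n\<ge>1. KL (\<rho> n) \<pi> \<le> ereal (C * sqrt (real n))"
    and V_init: "(\<integral>\<^sup>+x. ennreal (V x * q0 x) \<partial>\<mu>) < \<infinity>"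
  shows "\<exists>\<epsilon> :: nat \<Rightarrow> real.
           (\<exists>K. \<forall>n\<ge>1. \<epsilon> n \<le> K * max (1 / sqrt (real n)) (real n powr (\<delta> / 2) / real n)) \<and>
           (\<forall>n\<ge>1.
              enn2ereal (\<integral>\<^sup>+\<theta>. e2ennreal (KL (pathlaw \<mu> q0 p \<theta>0 n) (pathlaw \<mu> q0 p \<theta> n)) \<partial>\<rho> n)
                 \<le> ereal (real n * \<epsilon> n) \<and>
              enn2ereal (\<integral>\<^sup>+\<theta>. Var (pathlaw \<mu> q0 p \<theta>0 n) (rn q0 p \<theta> \<theta>0 n) \<partial>\<rho> n)
                 \<le> ereal (real n * \<epsilon> n) \<and>
              KL (\<rho> n) \<pi> \<le> ereal (real n * \<epsilon> n))"
proof -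
  have space: "space \<mu> = S"
    using base by (auto simp: space_restrict_space)
  have base': "sigma_finite_measure \<mu> \<or> (\<exists>S. \<mu> = count_space S)"
    using base sigma_finite_restrict_lborel by auto
  have chain: "density_chain \<mu> q0 p \<theta>" if \<theta>: "\<theta> \<in> \<Theta>" for \<theta>
  proof
    have "(\<lambda>w. (\<theta>, w)) \<in> measurable (\<mu> \<Otimes>\<^sub>M \<mu>) (restrict_space borel \<Theta> \<Otimes>\<^sub>M \<mu> \<Otimes>\<^sub>M \<mu>)"
      using \<theta> by (intro measurable_Pair1') (simp add: space_restrict_space)
    from measurable_compose[OF this p_meas]
    show "(\<lambda>(y, x). p \<theta> y x) \<in> borel_measurable (\<mu> \<Otimes>\<^sub>M \<mu>)"
      by simp
  qed (use base' q0_meas q0_nonneg q0_int p_dens \<theta> in \<open>auto simp: space\<close>)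
  \<comment> \<open>The normalisation of \<open>q\<close> is contained in its being an invariant
    probability density.\<close>
  have q_prob: "(\<integral>\<^sup>+x. ennreal (q x) \<partial>\<mu>) = 1"
  proof -
    have "prob_space (density \<mu> (\<lambda>x. ennreal (q x)))"
      using q_inv by (simp add: invariant_prob_def)
    from prob_space.emeasure_space_1[OF this] show ?thesis
      using q_meas by (simp add: emeasure_density cong: nn_integral_cong)
  qed
  interpret density_chain \<mu> q0 p \<theta>0
    by (rule chain[OF theta0])
  interpret ergodic_chain \<mu> q0 p \<theta>0 V q R \<tau>
    by unfold_locales (use V_meas V_ge1 q_meas q_nonneg q_prob V_q tau geom V_init in \<open>auto simp: space\<close>)
  \<comment> \<open>In \<open>lip\<close> the first parameter is taken to be
    \<open>\<theta>0\<close> and the second \<open>\<theta>\<close>, so that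
    \<open>f k \<theta>2 \<theta>1\<close> becomes \<open>f k \<theta> \<theta>0\<close>, the
    function whose moments under \<open>\<rho> n\<close> are bounded.\<close>
  have dom: "dominated_chain \<mu> q0 p \<theta>0 V q R \<tau> \<theta> M (\<lambda>k. \<bar>f k \<theta> \<theta>0\<bar>) m \<delta>" if \<theta>: "\<theta> \<in> \<Theta>" for \<theta>
  proof (intro dominated_chain.intro dominated_chain_axioms.intro)
    show "ergodic_chain \<mu> q0 p \<theta>0 V q R \<tau>"
      by unfold_locales
    show "density_chain \<mu> q0 p \<theta>"
      by (rule chain[OF \<theta>])
    show "(\<lambda>(y, x). M k y x) \<in> borel_measurable (\<mu> \<Otimes>\<^sub>M \<mu>)" if "k \<in> {1..m}" for k
      using M_meas that by blast
    show "0 \<le> M k y x" if "k \<in> {1..m}" "x \<in> space \<mu>" "y \<in> space \<mu>" for k x y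
      using M_nonneg that by (simp add: space)
    show "p \<theta>0 y x = 0 \<longleftrightarrow> p \<theta> y x = 0" if "x \<in> space \<mu>" "y \<in> space \<mu>" for x y
      using lip \<theta> theta0 that unfolding space by blast
    show "\<bar>ln (p \<theta>0 y x) - ln (p \<theta> y x)\<bar> \<le> (\<Sum>k=1..m. M k y x * \<bar>f k \<theta> \<theta>0\<bar>)"
      if "x \<in> space \<mu>" "y \<in> space \<mu>" "0 < p \<theta>0 y x" for x y
      using lip \<theta> theta0 that unfolding space by blast
    show "(\<integral>\<^sup>+y. ennreal (M k y x powr (2 + \<delta>) * p \<theta>0 y x) \<partial>\<mu>) \<le> ennreal (V x)"
      if "k \<in> {1..m}" "x \<in> space \<mu>" for k x
      using M_mom that unfolding space by (blast intro: less_imp_le)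
  qed (use delta in auto)
  define F where "F \<theta> = (\<Sum>k=1..m. \<bar>f k \<theta> \<theta>0\<bar>)" for \<theta>
  have F_nonneg: "0 \<le> F \<theta>" for \<theta>
    by (simp add: F_def sum_nonneg)
  \<comment> \<open>From here on \<open>\<theta>\<close> enters the bounds only through
    \<open>F\<close>: \<open>mean_V\<close> and \<open>square_const\<close> belong to
    \<open>ergodic_chain\<close> at \<open>\<theta>0\<close>.\<close>
  have amp: "dominated_chain.amp (\<lambda>k. \<bar>f k \<theta> \<theta>0\<bar>) m = F \<theta> * sqrt (2 * real m)"
    "(dominated_chain.amp (\<lambda>k. \<bar>f k \<theta> \<theta>0\<bar>) m)\<^sup>2 = (F \<theta>)\<^sup>2 * (2 * real m)" if "\<theta> \<in> \<Theta>" for \<theta>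
    using dominated_chain.amp_def[OF dom[OF that]] dominated_chain.amp_square[OF dom[OF that]] by (simp_all add: F_def)
  have space_\<rho>: "space (\<rho> n) = \<Theta>" and sets_\<rho>: "sets (\<rho> n) = sets (restrict_space borel \<Theta>)" if "1 \<le> n" for n
  proof -
    show sets: "sets (\<rho> n) = sets (restrict_space borel \<Theta>)"
      using F rho_F that by blast
    show "space (\<rho> n) = \<Theta>"
      using sets_eq_imp_space_eq[OF sets] by (simp add: space_restrict_space)
  qed
  have f_meas': "(\<lambda>\<theta>. f k \<theta> \<theta>0) \<in> borel_measurable (\<rho> n)" if "1 \<le> n" "k \<in> {1..m}" for n k
    using f_meas that unfolding measurable_cong_sets[OF sets_\<rho>[OF that(1)] refl] by blast
  have F_meas: "F \<in> borel_measurable (\<rho> n)" if "1 \<le> n" for n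
    unfolding F_def using f_meas'[OF that] by measurable
  have F_int: "(\<integral>\<^sup>+\<theta>. ennreal (F \<theta>) \<partial>\<rho> n) \<le> ennreal (real m * (C / sqrt (real n)))" if n: "1 \<le> n" for n
  proof -
    have meas: "(\<lambda>\<theta>. ennreal \<bar>f k \<theta> \<theta>0\<bar>) \<in> borel_measurable (\<rho> n)" if "k \<in> {1..m}" for k
      using f_meas'[OF n that] by measurable
    have "(\<integral>\<^sup>+\<theta>. ennreal (F \<theta>) \<partial>\<rho> n) = (\<integral>\<^sup>+\<theta>. (\<Sum>k=1..m. ennreal \<bar>f k \<theta> \<theta>0\<bar>) \<partial>\<rho> n)"
      by (simp add: F_def sum_ennreal)
    also have "\<dots> = (\<Sum>k=1..m. \<integral>\<^sup>+\<theta>. ennreal \<bar>f k \<theta> \<theta>0\<bar> \<partial>\<rho> n)"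
      by (rule nn_integral_sum[OF meas])
    also have "\<dots> \<le> (\<Sum>k=1..m. ennreal (C / sqrt (real n)))"
      using f_mom2 n by (intro sum_mono) blast
    also have "\<dots> = ennreal (real m * (C / sqrt (real n)))"
      using C by (simp add: ennreal_of_nat_eq_real_of_nat flip: ennreal_mult)
    finally show ?thesis .
  qed
  have F2_int: "(\<integral>\<^sup>+\<theta>. ennreal ((F \<theta>)\<^sup>2) \<partial>\<rho> n) \<le> ennreal (real m * (real m * (2 * (C / sqrt (real n)))))"
    if n: "1 \<le> n" for n
  proof -
    let ?g = "\<lambda>k \<theta>. ennreal \<bar>f k \<theta> \<theta>0\<bar> + ennreal (\<bar>f k \<theta> \<theta>0\<bar> powr (2 + \<delta>))"
    have meas: "(\<lambda>\<theta>. ennreal \<bar>f k \<theta> \<theta>0\<bar>) \<in> borel_measurable (\<rho> n)"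
      "(\<lambda>\<theta>. ennreal (\<bar>f k \<theta> \<theta>0\<bar> powr (2 + \<delta>))) \<in> borel_measurable (\<rho> n)" if "k \<in> {1..m}" for k
      using f_meas'[OF n that] by measurable
    have meas': "?g k \<in> borel_measurable (\<rho> n)" if "k \<in> {1..m}" for k
      by (intro borel_measurable_add meas that)
    \<comment> \<open>The moments of order \<open>2 + \<delta>\<close> are of the smaller order
      \<open>1 / n\<close>; the first moments decide the order of the integral of \<open>F\<close>
      squared.\<close>
    have inv_n: "C / real n \<le> C / sqrt (real n)"
      using C n by (intro divide_left_mono) (auto simp: power2_eq_square intro!: real_le_lsqrt)
    have "(\<integral>\<^sup>+\<theta>. ennreal ((F \<theta>)\<^sup>2) \<partial>\<rho> n) \<le> (\<integral>\<^sup>+\<theta>. ennreal (real m) * (\<Sum>k=1..m. ?g k \<theta>) \<partial>\<rho> n)"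
    proof (rule nn_integral_mono)
      fix \<theta>
      have "(F \<theta>)\<^sup>2 \<le> real m * (\<Sum>k=1..m. \<bar>f k \<theta> \<theta>0\<bar>\<^sup>2)"
        using sum_square_le_card[of "\<lambda>k. \<bar>f k \<theta> \<theta>0\<bar>" "{1..m}"] by (simp add: F_def)
      also have "\<dots> \<le> real m * (\<Sum>k=1..m. \<bar>f k \<theta> \<theta>0\<bar> + \<bar>f k \<theta> \<theta>0\<bar> powr (2 + \<delta>))"
        using delta by (intro mult_left_mono sum_mono square_le_self_plus_powr) auto
      finally have "ennreal ((F \<theta>)\<^sup>2) \<le> ennreal (real m * (\<Sum>k=1..m. \<bar>f k \<theta> \<theta>0\<bar> + \<bar>f k \<theta> \<theta>0\<bar> powr (2 + \<delta>)))"
        by (rule ennreal_leI)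
      also have "\<dots> = ennreal (real m) * (\<Sum>k=1..m. ?g k \<theta>)"
        by (simp add: ennreal_mult sum_nonneg flip: sum_ennreal ennreal_plus)
      finally show "ennreal ((F \<theta>)\<^sup>2) \<le> ennreal (real m) * (\<Sum>k=1..m. ?g k \<theta>)" .
    qed
    also have "\<dots> = ennreal (real m) * (\<Sum>k=1..m. \<integral>\<^sup>+\<theta>. ?g k \<theta> \<partial>\<rho> n)"
      by (simp only: nn_integral_cmult[OF borel_measurable_sum[OF meas']] nn_integral_sum[OF meas'])
    also have "(\<Sum>k=1..m. \<integral>\<^sup>+\<theta>. ?g k \<theta> \<partial>\<rho> n) \<le> (\<Sum>k=1..m. ennreal (2 * (C / sqrt (real n))))"
    proof (rule sum_mono)
      fix k assume k: "k \<in> {1..m}"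
      have "(\<integral>\<^sup>+\<theta>. ?g k \<theta> \<partial>\<rho> n)
          = (\<integral>\<^sup>+\<theta>. ennreal \<bar>f k \<theta> \<theta>0\<bar> \<partial>\<rho> n) + (\<integral>\<^sup>+\<theta>. ennreal (\<bar>f k \<theta> \<theta>0\<bar> powr (2 + \<delta>)) \<partial>\<rho> n)"
        by (rule nn_integral_add[OF meas[OF k]])
      also have "\<dots> \<le> ennreal (C / sqrt (real n)) + ennreal (C / real n)"
        using f_mom1 f_mom2 n k by (intro add_mono) blast+
      also have "\<dots> \<le> ennreal (C / sqrt (real n)) + ennreal (C / sqrt (real n))"
        by (intro add_left_mono ennreal_leI inv_n)
      also have "\<dots> = ennreal (2 * (C / sqrt (real n)))"
        using C by (simp flip: ennreal_plus)
      finally show "(\<integral>\<^sup>+\<theta>. ?g k \<theta> \<partial>\<rho> n) \<le> ennreal (2 * (C / sqrt (real n)))" .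
    qed
    also have "ennreal (real m) * (\<Sum>k=1..m. ennreal (2 * (C / sqrt (real n))))
        = ennreal (real m * (real m * (2 * (C / sqrt (real n)))))"
      using C by (simp add: ennreal_of_nat_eq_real_of_nat flip: ennreal_mult)
    finally show ?thesis
      by (simp add: mult_left_mono)
  qed
  \<comment> \<open>Each of the three conditions gets a bound of the form
    \<open>real n * (k / sqrt (real n))\<close>: \<open>k\<close> is \<open>K1\<close> for the
    divergence, \<open>K2\<close> for the variance and \<open>C\<close> for the prior. The sum
    \<open>K\<close> gives one sequence for all three.\<close>
  define K1 where "K1 = sqrt (2 * real m) * mean_V * (real m * C)"
  define K2 where "K2 = 2 * real m * square_const * (real m * (real m * (2 * C)))"
  define K where "K = K1 + K2 + C"
  have K_nonneg: "0 \<le> K1" "0 \<le> K2" "0 < C"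
    using C mean_V_ge_1 square_const_nonneg by (auto simp: K1_def K2_def)
  have K_bounds: "real n * (k / sqrt (real n)) \<le> real n * (K / sqrt (real n))" if "k \<in> {K1, K2, C}" for k n
    using that K_nonneg by (intro mult_left_mono divide_right_mono) (auto simp: K_def)
  have C1: "(\<integral>\<^sup>+\<theta>. e2ennreal (KL (Law n) (pathlaw \<mu> q0 p \<theta> n)) \<partial>\<rho> n) \<le> ennreal (real n * (K1 / sqrt (real n)))"
    if n: "1 \<le> n" for n
  proof -
    \<comment> \<open>\<open>nn_integral_mono\<close> accepts arbitrary integrands, so only the
      dominating function \<open>F\<close> has to be measurable in \<theta>.\<close>
    have "(\<integral>\<^sup>+\<theta>. e2ennreal (KL (Law n) (pathlaw \<mu> q0 p \<theta> n)) \<partial>\<rho> n)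
        \<le> (\<integral>\<^sup>+\<theta>. ennreal (real n * (sqrt (2 * real m) * mean_V)) * ennreal (F \<theta>) \<partial>\<rho> n)"
    proof (rule nn_integral_mono)
      fix \<theta> assume "\<theta> \<in> space (\<rho> n)"
      then have \<theta>: "\<theta> \<in> \<Theta>"
        by (simp add: space_\<rho>[OF n])
      have "e2ennreal (KL (Law n) (pathlaw \<mu> q0 p \<theta> n)) \<le> e2ennreal (ereal (real n * (F \<theta> * sqrt (2 * real m) * mean_V)))"
        using dominated_chain.KL_le[OF dom[OF \<theta>], of n] unfolding amp(1)[OF \<theta>] by (rule e2ennreal_mono)
      also have "\<dots> = ennreal (real n * (sqrt (2 * real m) * mean_V)) * ennreal (F \<theta>)"
        using F_nonneg mean_V_ge_1 by (simp add: mult_ac flip: ennreal_mult)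
      finally show "e2ennreal (KL (Law n) (pathlaw \<mu> q0 p \<theta> n))
          \<le> ennreal (real n * (sqrt (2 * real m) * mean_V)) * ennreal (F \<theta>)" .
    qed
    also have "\<dots> = ennreal (real n * (sqrt (2 * real m) * mean_V)) * (\<integral>\<^sup>+\<theta>. ennreal (F \<theta>) \<partial>\<rho> n)"
      using F_meas[OF n] by (intro nn_integral_cmult) simp
    also have "\<dots> \<le> ennreal (real n * (sqrt (2 * real m) * mean_V)) * ennreal (real m * (C / sqrt (real n)))"
      by (intro mult_left_mono F_int n) simp
    also have "\<dots> = ennreal (real n * (K1 / sqrt (real n)))"
      using C mean_V_ge_1 by (simp add: K1_def mult_ac flip: ennreal_mult)
    finally show ?thesis .
  qed
  have C2: "(\<integral>\<^sup>+\<theta>. Var (Law n) (rn q0 p \<theta> \<theta>0 n) \<partial>\<rho> n) \<le> ennreal (real n * (K2 / sqrt (real n)))"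
    if n: "1 \<le> n" for n
  proof -
    have "(\<integral>\<^sup>+\<theta>. Var (Law n) (rn q0 p \<theta> \<theta>0 n) \<partial>\<rho> n)
        \<le> (\<integral>\<^sup>+\<theta>. ennreal (real n * (2 * real m * square_const)) * ennreal ((F \<theta>)\<^sup>2) \<partial>\<rho> n)"
    proof (rule nn_integral_mono)
      fix \<theta> assume "\<theta> \<in> space (\<rho> n)"
      then have \<theta>: "\<theta> \<in> \<Theta>"
        by (simp add: space_\<rho>[OF n])
      have "Var (Law n) (rn q0 p \<theta> \<theta>0 n) \<le> ennreal (real n * ((F \<theta>)\<^sup>2 * (2 * real m) * square_const))"
        using dominated_chain.Var_rn_le[OF dom[OF \<theta>], of n] unfolding amp(2)[OF \<theta>] .
      also have "\<dots> = ennreal (real n * (2 * real m * square_const)) * ennreal ((F \<theta>)\<^sup>2)"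
        using square_const_nonneg by (simp add: mult_ac flip: ennreal_mult)
      finally show "Var (Law n) (rn q0 p \<theta> \<theta>0 n)
          \<le> ennreal (real n * (2 * real m * square_const)) * ennreal ((F \<theta>)\<^sup>2)" .
    qed
    also have "\<dots> = ennreal (real n * (2 * real m * square_const)) * (\<integral>\<^sup>+\<theta>. ennreal ((F \<theta>)\<^sup>2) \<partial>\<rho> n)"
      using F_meas[OF n] by (intro nn_integral_cmult) simp
    also have "\<dots> \<le> ennreal (real n * (2 * real m * square_const)) * ennreal (real m * (real m * (2 * (C / sqrt (real n)))))"
      by (intro mult_left_mono F2_int n) simp
    also have "\<dots> = ennreal (real n * (K2 / sqrt (real n)))"
      using C square_const_nonneg by (simp add: K2_def mult_ac flip: ennreal_mult)
    finally show ?thesis .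
  qed
  have to_ereal: "enn2ereal A \<le> ereal (real n * (K / sqrt (real n)))"
    if "A \<le> ennreal (real n * (k / sqrt (real n)))" "k \<in> {K1, K2}" for A k n
  proof -
    have "A \<le> ennreal (real n * (K / sqrt (real n)))"
      using that K_bounds[of k n] by (auto intro: order_trans ennreal_leI)
    then have "enn2ereal A \<le> enn2ereal (ennreal (real n * (K / sqrt (real n))))"
      by (simp add: less_eq_ennreal.rep_eq)
    then show ?thesis
      using K_nonneg by (simp add: enn2ereal_ennreal K_def)
  qed
  show ?thesis
  proof (intro exI[of _ "\<lambda>n. K / sqrt (real n)"] conjI exI[of _ K] allI impI)
    fix n :: nat assume n: "1 \<le> n"
    have "K * (1 / sqrt (real n)) \<le> K * max (1 / sqrt (real n)) (real n powr (\<delta> / 2) / real n)"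
      using K_nonneg by (intro mult_left_mono) (auto simp: K_def)
    then show "K / sqrt (real n) \<le> K * max (1 / sqrt (real n)) (real n powr (\<delta> / 2) / real n)"
      by simp
    show "enn2ereal (\<integral>\<^sup>+\<theta>. e2ennreal (KL (pathlaw \<mu> q0 p \<theta>0 n) (pathlaw \<mu> q0 p \<theta> n)) \<partial>\<rho> n)
        \<le> ereal (real n * (K / sqrt (real n)))"
      by (rule to_ereal[OF C1[OF n]]) simp
    show "enn2ereal (\<integral>\<^sup>+\<theta>. Var (pathlaw \<mu> q0 p \<theta>0 n) (rn q0 p \<theta> \<theta>0 n) \<partial>\<rho> n)
        \<le> ereal (real n * (K / sqrt (real n)))"
      by (rule to_ereal[OF C2[OF n]]) simp
    \<comment> \<open>This puts the bound \<open>C * sqrt (real n)\<close> on the prior term into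
      the form shared by the other two.\<close>
    have "real n * (C / sqrt (real n)) = C * (real n / sqrt (real n))"
      by simp
    also have "\<dots> = C * sqrt (real n)"
      by (simp only: real_div_sqrt of_nat_0_le_iff)
    finally have "C * sqrt (real n) \<le> real n * (K / sqrt (real n))"
      using K_bounds[of C n] by simp
    then show "KL (\<rho> n) \<pi> \<le> ereal (real n * (K / sqrt (real n)))"
      using KL_rho n by (meson ereal_less_eq(3) order_trans)
  qed
qed

end
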